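(* Let $A$ be a central simple $F$-algebra of degree $4$ and let $\sigma$ be an orthogonal involution on $A$. Then $(A,\sigma)_{F_Q}$ is hyperbolic if and only if $(A,\sigma)$ is hyperbolic or contains $(Q,\bar{\ })$.
   Context: $F$ is a field of characteristic different from $2$; involutions are of the first kind ($F$-linear). $Q=(a,b)_F$, with $a,b\in F^\times$, is a quaternion algebra that is assumed not split, and $\bar{\ }$ is its canonical (symplectic) involution. $F_Q$ is the function field of the conic (Severi–Brauer variety) of $Q$. For a field extension $K/F$, $(A,\sigma)_K=(A\otimes_F K,\sigma\otimes\mathrm{Id})$. An involution $\sigma$ is hyperbolic if there is an idempotent $e$ with $\sigma(e)=1-e$. $(A,\sigma)$ contains $(B,\tau)$ if $A$ contains a $\sigma$-stable $F$-subalgebra isomorphic to $B$ such that the restriction of $\sigma$ corresponds to a conjugate of $\tau$; equivalently $(A,\sigma)\simeq(B,\tau)\otimes(C,\gamma)$ for some central simple algebra with involution $(C,\gamma)$. *)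

theory Defs
  imports
    "HOL-Analysis.Cartesian_Space"
    "HOL-Library.Poly_Mapping"
    "HOL-Library.Product_Plus"
    "HOL-Computational_Algebra.Polynomial"
begin

section \<open>Algebras over a field\<close>

text \<open>
  Multiplication and unit are explicit parameters rather than type class operations, because
  the product of a quaternion algebra depends on two field elements and the product of a matrix
  algebra is not the class operation on its type.
\<close>

locale assoc_algebra = vector_space scale
  for scale :: "'f::field \<Rightarrow> 'a::ab_group_add \<Rightarrow> 'a" +
  fixes mul :: "'a \<Rightarrow> 'a \<Rightarrow> 'a" and one :: 'a
  assumes mul_assoc: "mul (mul x y) z = mul x (mul y z)"
    and mul_add_left: "mul (x + y) z = mul x z + mul y z"
    and mul_add_right: "mul x (y + z) = mul x y + mul x z"
    and mul_scale_left: "mul (scale c x) y = scale c (mul x y)"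
    and mul_scale_right: "mul x (scale c y) = scale c (mul x y)"
    and mul_one_left: "mul one x = x"
    and mul_one_right: "mul x one = x"

locale central_simple_algebra = assoc_algebra +
  assumes finite_dim: "\<exists>B. finite B \<and> span B = UNIV"
    and central: "(\<forall>y. mul x y = mul y x) \<Longrightarrow> \<exists>c. x = scale c one"
    and nontrivial: "one \<noteq> 0"
    and simple: "\<lbrakk>subspace I; \<And>x y. y \<in> I \<Longrightarrow> mul x y \<in> I; \<And>x y. y \<in> I \<Longrightarrow> mul y x \<in> I\<rbrakk>
                  \<Longrightarrow> I = {0} \<or> I = UNIV"

definition has_degree :: "('f::field \<Rightarrow> 'a::ab_group_add \<Rightarrow> 'a) \<Rightarrow> nat \<Rightarrow> bool" where
  "has_degree scl n \<longleftrightarrow> vector_space.dim scl UNIV = n\<^sup>2"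

definition algebra_hom ::
  "('f::field \<Rightarrow> 'a::ab_group_add \<Rightarrow> 'a) \<Rightarrow> ('a \<Rightarrow> 'a \<Rightarrow> 'a) \<Rightarrow> 'a \<Rightarrow>
   ('f \<Rightarrow> 'b::ab_group_add \<Rightarrow> 'b) \<Rightarrow> ('b \<Rightarrow> 'b \<Rightarrow> 'b) \<Rightarrow> 'b \<Rightarrow> ('a \<Rightarrow> 'b) \<Rightarrow> bool" where
  "algebra_hom scl mul one scl' mul' one' \<phi> \<longleftrightarrow>
     Vector_Spaces.linear scl scl' \<phi> \<and>
     (\<forall>x y. \<phi> (mul x y) = mul' (\<phi> x) (\<phi> y)) \<and> \<phi> one = one'"

definition mat_scale :: "'f::field \<Rightarrow> 'f^'n^'n \<Rightarrow> 'f^'n^'n" where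
  "mat_scale c M = (\<chi> i j. c * M $ i $ j)"


section \<open>Scalar extension\<close>

definition field_hom :: "('f::field \<Rightarrow> 'k::field) \<Rightarrow> bool" where
  "field_hom \<epsilon> \<longleftrightarrow> (\<forall>x y. \<epsilon> (x + y) = \<epsilon> x + \<epsilon> y) \<and> (\<forall>x y. \<epsilon> (x * y) = \<epsilon> x * \<epsilon> y) \<and> \<epsilon> 1 = 1"

text \<open>
  For a field extension \<open>\<epsilon> : F \<rightarrow> K\<close> and an \<open>F\<close>-vector space \<open>A\<close>, the \<open>K\<close>-vector space \<open>A \<otimes>\<^sub>F K\<close> is
  the quotient of the free \<open>K\<close>-vector space on the set \<open>A\<close> (finitely supported functions, with
  \<open>x \<otimes> k\<close> the class of \<open>single x k\<close>) by the span of the following relations.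
\<close>

definition free_scale :: "'k::field \<Rightarrow> ('a \<Rightarrow>\<^sub>0 'k) \<Rightarrow> ('a \<Rightarrow>\<^sub>0 'k)" where
  "free_scale k p = Poly_Mapping.map ((*) k) p"

definition tensor_relations ::
  "('f::field \<Rightarrow> 'a::ab_group_add \<Rightarrow> 'a) \<Rightarrow> ('f \<Rightarrow> 'k::field) \<Rightarrow> ('a \<Rightarrow>\<^sub>0 'k) set" where
  "tensor_relations scl \<epsilon> =
     {Poly_Mapping.single (x + y) 1 - Poly_Mapping.single x 1 - Poly_Mapping.single y 1 | x y. True} \<union>
     {Poly_Mapping.single (scl c x) 1 - Poly_Mapping.single x (\<epsilon> c) | c x. True}"

definition tensor_eval ::
  "('k::field \<Rightarrow> 'b::ab_group_add \<Rightarrow> 'b) \<Rightarrow> ('a \<Rightarrow> 'b) \<Rightarrow> ('a \<Rightarrow>\<^sub>0 'k) \<Rightarrow> 'b" where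
  "tensor_eval scaleK \<iota> p = (\<Sum>x\<in>Poly_Mapping.keys p. scaleK (Poly_Mapping.lookup p x) (\<iota> x))"

text \<open>
  The \<open>K\<close>-algebra \<open>B\<close>, with \<open>\<iota> : A \<rightarrow> B\<close>, \<open>x \<mapsto> x \<otimes> 1\<close>, is (a copy of) \<open>A \<otimes>\<^sub>F K\<close>: the map
  \<open>x \<otimes> k \<mapsto> k \<iota>(x)\<close> from the quotient above to \<open>B\<close> is well defined and bijective, and it carries the
  product of \<open>A \<otimes>\<^sub>F K\<close> to that of \<open>B\<close>. This determines \<open>B\<close> up to unique isomorphism; it is a
  predicate because a type cannot depend on \<open>scl\<close> and \<open>\<epsilon>\<close>.
\<close>

definition scalar_extension ::
  "('f::field \<Rightarrow> 'a::ab_group_add \<Rightarrow> 'a) \<Rightarrow> ('a \<Rightarrow> 'a \<Rightarrow> 'a) \<Rightarrow> 'a \<Rightarrow> ('f \<Rightarrow> 'k::field) \<Rightarrow>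
   ('k \<Rightarrow> 'b::ab_group_add \<Rightarrow> 'b) \<Rightarrow> ('b \<Rightarrow> 'b \<Rightarrow> 'b) \<Rightarrow> 'b \<Rightarrow> ('a \<Rightarrow> 'b) \<Rightarrow> bool" where
  "scalar_extension scl mul one \<epsilon> scaleK mulK oneK \<iota> \<longleftrightarrow>
     field_hom \<epsilon> \<and>
     assoc_algebra scaleK mulK oneK \<and>
     (\<forall>x y. \<iota> (mul x y) = mulK (\<iota> x) (\<iota> y)) \<and> \<iota> one = oneK \<and>
     range (tensor_eval scaleK \<iota>) = UNIV \<and>
     {p. tensor_eval scaleK \<iota> p = 0} = module.span free_scale (tensor_relations scl \<epsilon>)"

text \<open>The map \<open>f \<otimes> Id\<close>; it is unique since \<open>range \<iota>\<close> spans \<open>A \<otimes>\<^sub>F K\<close> over \<open>K\<close>.\<close>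

definition extended_map ::
  "('k::field \<Rightarrow> 'b::ab_group_add \<Rightarrow> 'b) \<Rightarrow> ('a \<Rightarrow> 'b) \<Rightarrow> ('a \<Rightarrow> 'a) \<Rightarrow> ('b \<Rightarrow> 'b) \<Rightarrow> bool" where
  "extended_map scaleK \<iota> f fK \<longleftrightarrow>
     Vector_Spaces.linear scaleK scaleK fK \<and> (\<forall>x. fK (\<iota> x) = \<iota> (f x))"


section \<open>Involutions of the first kind\<close>

definition involution ::
  "('f::field \<Rightarrow> 'a::ab_group_add \<Rightarrow> 'a) \<Rightarrow> ('a \<Rightarrow> 'a \<Rightarrow> 'a) \<Rightarrow> ('a \<Rightarrow> 'a) \<Rightarrow> bool" where
  "involution scl mul \<sigma> \<longleftrightarrow>
     Vector_Spaces.linear scl scl \<sigma> \<and>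
     (\<forall>x y. \<sigma> (mul x y) = mul (\<sigma> y) (\<sigma> x)) \<and> (\<forall>x. \<sigma> (\<sigma> x) = x)"

definition symmetric_nondegenerate_form :: "('l::field^'n \<Rightarrow> 'l^'n \<Rightarrow> 'l) \<Rightarrow> bool" where
  "symmetric_nondegenerate_form \<beta> \<longleftrightarrow>
     (\<forall>v. Vector_Spaces.linear (*s) (*) (\<beta> v)) \<and>
     (\<forall>v w. \<beta> v w = \<beta> w v) \<and>
     (\<forall>v. (\<forall>w. \<beta> v w = 0) \<longrightarrow> v = 0)"

text \<open>
  In characteristic different from \<open>2\<close>, an involution of the first kind on a central simple algebra
  \<open>A\<close> of degree \<open>n\<close> is orthogonal if, for some (equivalently, every) field \<open>L\<close> splitting \<open>A\<close>, there is
  an isomorphism of \<open>A \<otimes>\<^sub>F L\<close> with the endomorphism algebra of \<open>L\<^sup>n\<close> under which \<open>\<sigma> \<otimes> Id\<close> becomes the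
  adjoint involution of a nondegenerate symmetric bilinear form. The type arguments name \<open>L\<close> and
  an index type with \<open>n\<close> elements; as a hypothesis with \<open>L\<close> a type variable, the
  condition says that such an \<open>L\<close> exists.
\<close>

definition orthogonal_involution ::
  "'l::field itself \<Rightarrow> 'n::finite itself \<Rightarrow>
   ('f::field \<Rightarrow> 'a::ab_group_add \<Rightarrow> 'a) \<Rightarrow> ('a \<Rightarrow> 'a \<Rightarrow> 'a) \<Rightarrow> 'a \<Rightarrow> ('a \<Rightarrow> 'a) \<Rightarrow> bool" where
  "orthogonal_involution _ _ scl mul one \<sigma> \<longleftrightarrow>
     involution scl mul \<sigma> \<and>
     (\<exists>(\<epsilon> :: 'f \<Rightarrow> 'l) (\<phi> :: 'a \<Rightarrow> 'l^'n^'n) (\<tau> :: 'l^'n^'n \<Rightarrow> 'l^'n^'n) \<beta>.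
        scalar_extension scl mul one \<epsilon> mat_scale (**) (mat 1) \<phi> \<and>
        extended_map mat_scale \<phi> \<sigma> \<tau> \<and>
        symmetric_nondegenerate_form \<beta> \<and>
        (\<forall>M v w. \<beta> (M *v v) w = \<beta> v (\<tau> M *v w)))"

definition hyperbolic ::
  "('a::ab_group_add \<Rightarrow> 'a \<Rightarrow> 'a) \<Rightarrow> 'a \<Rightarrow> ('a \<Rightarrow> 'a) \<Rightarrow> bool" where
  "hyperbolic mul one \<sigma> \<longleftrightarrow> (\<exists>e. mul e e = e \<and> \<sigma> e = one - e)"

text \<open>
  \<open>(A, \<sigma>)\<close> contains \<open>(B, \<tau>)\<close>: the subalgebra of \<open>A\<close> isomorphic to \<open>B\<close> is \<open>range \<phi>\<close>, which is
  \<open>\<sigma>\<close>-stable by the last conjunct; with \<open>v\<close> the inverse of \<open>u\<close>, the restriction of \<open>\<sigma>\<close> corresponds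
  under \<open>\<phi>\<close> to \<open>Int(u) \<circ> \<tau> \<circ> Int(u)\<inverse>\<close>.
\<close>

definition contains_with_involution ::
  "('f::field \<Rightarrow> 'a::ab_group_add \<Rightarrow> 'a) \<Rightarrow> ('a \<Rightarrow> 'a \<Rightarrow> 'a) \<Rightarrow> 'a \<Rightarrow> ('a \<Rightarrow> 'a) \<Rightarrow>
   ('f \<Rightarrow> 'b::ab_group_add \<Rightarrow> 'b) \<Rightarrow> ('b \<Rightarrow> 'b \<Rightarrow> 'b) \<Rightarrow> 'b \<Rightarrow> ('b \<Rightarrow> 'b) \<Rightarrow> bool" where
  "contains_with_involution scaleA mulA oneA \<sigma> scaleB mulB oneB \<tau> \<longleftrightarrow>
     (\<exists>\<phi> u v. algebra_hom scaleB mulB oneB scaleA mulA oneA \<phi> \<and> inj \<phi> \<and>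
        mulB u v = oneB \<and> mulB v u = oneB \<and>
        (\<forall>x. \<sigma> (\<phi> x) = \<phi> (mulB u (mulB (\<tau> (mulB v (mulB x u))) v))))"


section \<open>Quaternion algebras and the function field of their conic\<close>

text \<open>
  \<open>(a,b)\<^sub>F\<close> has basis \<open>1, i, j, ij\<close> with \<open>i\<^sup>2 = a\<close>, \<open>j\<^sup>2 = b\<close>, \<open>ji = -ij\<close>; quadruples are coordinates
  in this basis.
\<close>

type_synonym 'f quat = "'f \<times> 'f \<times> 'f \<times> 'f"

definition quat_scale :: "'f::field \<Rightarrow> 'f quat \<Rightarrow> 'f quat" where
  "quat_scale c = (\<lambda>(x0, x1, x2, x3). (c * x0, c * x1, c * x2, c * x3))"

definition quat_mul :: "'f::field \<Rightarrow> 'f \<Rightarrow> 'f quat \<Rightarrow> 'f quat \<Rightarrow> 'f quat" where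
  "quat_mul a b = (\<lambda>(x0, x1, x2, x3) (y0, y1, y2, y3).
     (x0 * y0 + a * x1 * y1 + b * x2 * y2 - a * b * x3 * y3,
      x0 * y1 + x1 * y0 - b * x2 * y3 + b * x3 * y2,
      x0 * y2 + x2 * y0 + a * x1 * y3 - a * x3 * y1,
      x0 * y3 + x3 * y0 + x1 * y2 - x2 * y1))"

definition quat_one :: "'f::field quat" where
  "quat_one = (1, 0, 0, 0)"

definition quat_conj :: "'f::field quat \<Rightarrow> 'f quat" where
  "quat_conj = (\<lambda>(x0, x1, x2, x3). (x0, - x1, - x2, - x3))"

lemma quat_vector_space: "vector_space (quat_scale :: 'f::field \<Rightarrow> _)"
  by unfold_locales (auto simp: quat_scale_def algebra_simps)

lemma quat_assoc_algebra:
  "assoc_algebra quat_scale (quat_mul a b) (quat_one :: 'f::field quat)"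
  by (intro assoc_algebra.intro quat_vector_space assoc_algebra_axioms.intro;
      auto simp: quat_scale_def quat_mul_def quat_one_def algebra_simps)

lemma quat_conj_involution:
  "involution quat_scale (quat_mul a b) (quat_conj :: 'f::field quat \<Rightarrow> _)"
  unfolding involution_def
  by (auto simp: Vector_Spaces.linear_iff quat_vector_space quat_scale_def quat_mul_def
        quat_conj_def algebra_simps)

definition quat_split :: "'f::field \<Rightarrow> 'f \<Rightarrow> bool" where
  "quat_split a b \<longleftrightarrow>
     (\<exists>\<phi> :: 'f quat \<Rightarrow> 'f^2^2.
        algebra_hom quat_scale (quat_mul a b) quat_one mat_scale (**) (mat 1) \<phi> \<and> bij \<phi>)"

text \<open>
  The conic of \<open>(a,b)\<^sub>F\<close> is the projective curve \<open>a X\<^sup>2 + b Y\<^sup>2 = Z\<^sup>2\<close>. An element of \<open>'f poly poly\<close> is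
  read as a polynomial in \<open>Y\<close> with coefficients in \<open>F[X]\<close>; \<open>conic_poly a b\<close> is the affine equation
  \<open>a X\<^sup>2 + b Y\<^sup>2 - 1\<close>.
\<close>

definition conic_poly :: "'f::field \<Rightarrow> 'f \<Rightarrow> 'f poly poly" where
  "conic_poly a b = [: [:-1, 0, a:], 0, [:b:] :]"

definition eval2 :: "('f::field \<Rightarrow> 'k::field) \<Rightarrow> 'k \<Rightarrow> 'k \<Rightarrow> 'f poly poly \<Rightarrow> 'k" where
  "eval2 \<epsilon> x y p = poly (map_poly (\<lambda>q. poly (map_poly \<epsilon> q) x) p) y"

text \<open>
  The field \<open>K\<close>, with \<open>\<epsilon> : F \<rightarrow> K\<close>, is (a copy of) the function field of the conic: evaluation at
  \<open>(x, y)\<close> embeds the coordinate ring \<open>F[X,Y]/(a X\<^sup>2 + b Y\<^sup>2 - 1)\<close> of the affine conic into \<open>K\<close>, and \<open>K\<close>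
  is the field of fractions of the image.
\<close>

definition conic_function_field :: "'f::field \<Rightarrow> 'f \<Rightarrow> ('f \<Rightarrow> 'k::field) \<Rightarrow> bool" where
  "conic_function_field a b \<epsilon> \<longleftrightarrow>
     field_hom \<epsilon> \<and>
     (\<exists>x y. (\<forall>p. eval2 \<epsilon> x y p = 0 \<longleftrightarrow> conic_poly a b dvd p) \<and>
            (\<forall>z. \<exists>p q. eval2 \<epsilon> x y q \<noteq> 0 \<and> z = eval2 \<epsilon> x y p / eval2 \<epsilon> x y q))"

end

theory Submission
  imports Defs
begin

text \<open>
  Let \<open>S\<close> be the space of skew-symmetric elements of \<open>(A, \<sigma>)\<close>; \<open>\<sigma>\<close> is hyperbolic if and only if
  some \<open>s \<in> S\<close> has \<open>s\<^sup>2 = 1\<close>. In degree \<open>4\<close> there is a nonzero linear map \<open>p : S \<rightarrow> S\<close>, the Pfaffian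
  adjoint, with \<open>r p(r) \<in> F\<close> for all \<open>r \<in> S\<close>. If \<open>s\<^sup>2 = 1\<close> over the function field \<open>K\<close> of the conic, then
  \<open>p(s) = \<kappa> s\<close> and \<open>p\<^sup>2 = \<kappa>\<^sup>2\<close>; since \<open>\<kappa>\<^sup>2 \<in> F\<close> and \<open>F\<close> is quadratically closed in \<open>K\<close>, one may scale \<open>p\<close> so that
  \<open>p\<^sup>2 = 1\<close> and \<open>p(s) = s\<close>. The fixed space of \<open>p\<close> consists of the pure quaternions of an \<open>F\<close>-subalgebra
  \<open>(c,d)\<close> (unless it contains an isotropic vector, and then \<open>\<sigma>\<close> is hyperbolic), so \<open>\<langle>c, d, -cd\<rangle>\<close> represents
  \<open>1\<close> over \<open>K\<close>. If it does not represent \<open>1\<close> over \<open>F\<close>, it represents \<open>b - a b X\<^sup>2\<close> over \<open>F(X)\<close>, hence by the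
  Cassels-Pfister theorem by a polynomial vector \<open>v\<^sub>0 + v\<^sub>1 X\<close>. Then \<open>v\<^sub>0\<close> and \<open>v\<^sub>1\<close> anticommute and have squares
  \<open>b\<close> and \<open>-ab\<close>, so they generate a copy of \<open>(a,b)\<close> on which \<open>\<sigma>\<close> is the canonical involution.
\<close>


section \<open>The Cassels-Pfister theorem for diagonal forms\<close>

text \<open>Vectors are functions on \<open>nat\<close> of which only the first \<open>n\<close>
  values count, so that one definition serves \<open>F\<close>, \<open>F[X]\<close> and
  \<open>K\<close>.\<close>

definition diag_bilin :: "nat \<Rightarrow> (nat \<Rightarrow> 'r::comm_ring_1) \<Rightarrow> (nat \<Rightarrow> 'r) \<Rightarrow> (nat \<Rightarrow> 'r) \<Rightarrow> 'r" where
  "diag_bilin n c u v = (\<Sum>i<n. c i * u i * v i)"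

definition anisotropic :: "nat \<Rightarrow> (nat \<Rightarrow> 'r::comm_ring_1) \<Rightarrow> bool" where
  "anisotropic n c \<longleftrightarrow> (\<forall>u. diag_bilin n c u u = 0 \<longrightarrow> (\<forall>i<n. u i = 0))"

lemma diag_bilin_lincomb:
  "diag_bilin n c (\<lambda>i. A * u i + B * v i) (\<lambda>i. A * u i + B * v i) =
     A * A * diag_bilin n c u u + 2 * A * B * diag_bilin n c u v + B * B * diag_bilin n c v v"
  unfolding diag_bilin_def sum_distrib_left sum.distrib[symmetric]
  by (intro sum.cong refl) (simp add: algebra_simps)

lemma coeff_mult_degree_le:
  fixes p q :: "'r::comm_ring_1 poly"
  assumes "degree p \<le> m" "degree q \<le> k"
  shows "coeff (p * q) (m + k) = coeff p m * coeff q k"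
proof -
  have "coeff (p * q) (m + k) = (\<Sum>i\<le>m + k. coeff p i * coeff q (m + k - i))"
    by (simp add: coeff_mult)
  also have "\<dots> = (\<Sum>i\<in>{m}. coeff p i * coeff q (m + k - i))"
  proof (rule sum.mono_neutral_right)
    show "\<forall>i\<in>{..m + k} - {m}. coeff p i * coeff q (m + k - i) = 0"
    proof
      fix i assume "i \<in> {..m + k} - {m}"
      then consider "i > m" | "m + k - i > k" by force
      then show "coeff p i * coeff q (m + k - i) = 0"
        using assms by cases (auto simp: coeff_eq_0)
    qed
  qed auto
  finally show ?thesis by simp
qed

lemma coeff_diag_bilin:
  fixes c :: "nat \<Rightarrow> 'r::comm_ring_1" and u :: "nat \<Rightarrow> 'r poly"
  assumes "\<And>i. i < n \<Longrightarrow> degree (u i) \<le> m"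
  shows "coeff (diag_bilin n (\<lambda>i. [:c i:]) u u) (2 * m) =
           diag_bilin n c (\<lambda>i. coeff (u i) m) (\<lambda>i. coeff (u i) m)"
  unfolding diag_bilin_def coeff_sum
proof (intro sum.cong refl)
  fix i assume "i \<in> {..<n}"
  then have "coeff (u i * u i) (2 * m) = coeff (u i) m * coeff (u i) m"
    using coeff_mult_degree_le[of "u i" m "u i" m] assms[of i] by (simp add: mult_2)
  then show "coeff ([:c i:] * u i * u i) (2 * m) = c i * coeff (u i) m * coeff (u i) m"
    by (simp add: mult.assoc)
qed

text \<open>No cancellation at the top: if \<open>m\<close> is the largest degree of a component,
  the coefficient of \<open>X^(2m)\<close> is the value of the form at the vector of
  \<open>m\<close>-th coefficients, which is nonzero by anisotropy.\<close>

lemma anisotropic_poly: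
  fixes c :: "nat \<Rightarrow> 'r::comm_ring_1" and u :: "nat \<Rightarrow> 'r poly"
  assumes an: "anisotropic n c" and "j < n" "u j \<noteq> 0"
  shows "diag_bilin n (\<lambda>i. [:c i:]) u u \<noteq> 0"
    and "i < n \<Longrightarrow> 2 * degree (u i) \<le> degree (diag_bilin n (\<lambda>i. [:c i:]) u u)"
proof -
  define m where "m = Max ((\<lambda>i. degree (u i)) ` {..<n})"
  have le: "degree (u i) \<le> m" if "i < n" for i
    unfolding m_def using that by (intro Max_ge) auto
  have "m \<in> (\<lambda>i. degree (u i)) ` {..<n}"
    unfolding m_def using \<open>j < n\<close> by (intro Max_in) auto
  then obtain k where k: "k < n" "degree (u k) = m" by auto
  have "\<exists>i<n. coeff (u i) m \<noteq> 0"
  \<comment> \<open>The zero polynomial has degree 0, so \<open>u k = 0\<close> forces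
    \<open>m = 0\<close>; the nonzero \<open>u j\<close> then has degree \<open>m\<close> as
    well.\<close>
  proof (cases "u k = 0")
    case True
    then have "degree (u j) = m" using k le[OF \<open>j < n\<close>] by auto
    then show ?thesis using assms leading_coeff_neq_0 by blast
  next
    case False
    then show ?thesis using k leading_coeff_neq_0 by blast
  qed
  then have nz: "coeff (diag_bilin n (\<lambda>i. [:c i:]) u u) (2 * m) \<noteq> 0"
    using an unfolding anisotropic_def by (subst coeff_diag_bilin) (auto simp: le)
  then show "diag_bilin n (\<lambda>i. [:c i:]) u u \<noteq> 0" by auto
  show "2 * degree (u i) \<le> degree (diag_bilin n (\<lambda>i. [:c i:]) u u)" if "i < n"
    using le_degree[OF nz] le[OF that] by simp
qed

text \<open>Descent on the degree of the denominator \<open>t\<close>. Rounding \<open>v / t\<close>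
  to the polynomial vector \<open>u\<close> and intersecting the quadric with the line through both
  points gives a solution with denominator \<open>t' = q(r) / t\<close>; the remainders
  \<open>r\<close> have degree below that of \<open>t\<close>, hence so has \<open>t'\<close>. If
  all remainders vanish, \<open>u\<close> is the answer.\<close>

theorem cassels_pfister:
  fixes c :: "nat \<Rightarrow> 'f::field" and v :: "nat \<Rightarrow> 'f poly"
  assumes an: "anisotropic n c"
    and "t \<noteq> 0" "diag_bilin n (\<lambda>i. [:c i:]) v v = g * (t * t)"
  shows "\<exists>w. diag_bilin n (\<lambda>i. [:c i:]) w w = g"
  using assms(2,3)
proof (induction "degree t" arbitrary: t v rule: less_induct)
  case less
  define q where "q = diag_bilin n (\<lambda>i. [:c i:])"
  define u where "u = (\<lambda>i. v i div t)"
  define r where "r = (\<lambda>i. v i mod t)"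
  have r_eq: "r = (\<lambda>i. 1 * v i + (- t) * u i)"
    unfolding r_def u_def using less.prems(1) by (simp add: minus_div_mult_eq_mod[symmetric] mult.commute)
  have v_eq: "v i = t * u i + r i" for i unfolding u_def r_def by simp
  show ?case
  proof (cases "\<forall>i<n. r i = 0")
    case True
    then have "q v v = (t * t) * q u u"
      unfolding q_def diag_bilin_def sum_distrib_left
      by (intro sum.cong refl) (use v_eq in \<open>auto simp: algebra_simps\<close>)
    then have "q u u = g" using less.prems unfolding q_def by (simp add: mult.commute)
    then show ?thesis unfolding q_def by blast
  next
    case False
    then obtain j where j: "j < n" "r j \<noteq> 0" by auto
    \<comment> \<open>\<open>(v', t')\<close> is the second intersection of the quadric \<open>q(v) = g t\<^sup>2\<close> with the line
      through \<open>(v, t)\<close> and \<open>(u, 1)\<close>.\<close>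
    define A where "A = q u u - g"
    define B where "B = 2 * q v u - 2 * g * t"
    define v' where "v' = (\<lambda>i. A * v i + (- B) * u i)"
    define t' where "t' = A * t - B"
    have qv: "q v v = g * (t * t)" using less.prems(2) by (simp add: q_def)
    have "q r r = q v v - 2 * t * q v u + t * t * q u u"
      unfolding q_def r_eq by (subst diag_bilin_lincomb) simp
    then have qr: "q r r = t * t'"
      unfolding t'_def A_def B_def qv by (simp add: algebra_simps)
    have "q r r \<noteq> 0" unfolding q_def using anisotropic_poly(1)[of n c j r] an j by blast
    then have t'0: "t' \<noteq> 0" using qr by auto
    have "q v' v' = A * A * q v v + 2 * A * (- B) * q v u + (- B) * (- B) * q u u"
      unfolding q_def v'_def by (rule diag_bilin_lincomb)
    also have "\<dots> = g * (t' * t') + B * (B * A - A * (2 * q v u - 2 * g * t))"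
      unfolding t'_def qv by (simp add: A_def algebra_simps)
    also have "\<dots> = g * (t' * t')" by (simp add: B_def)
    finally have qv': "q v' v' = g * (t' * t')" .
    have dr: "degree (r i) < degree t" for i
    proof (cases "degree t = 0")
      case True
      then have "t dvd v j" using less.prems(1) by (simp add: is_unit_iff_degree unit_imp_dvd)
      then have "r j = 0" by (simp add: r_def)
      then show ?thesis using j by simp
    next
      case False
      then show ?thesis unfolding r_def using degree_mod_less'[of t "v i"] less.prems(1)
        by (cases "v i mod t = 0") auto
    qed
    have "degree (q r r) < 2 * degree t"
    proof -
      \<comment> \<open>The truncated subtraction is harmless: \<open>dr\<close> gives
        \<open>0 < degree t\<close>.\<close>
      have "degree (q r r) \<le> 2 * (degree t - 1)"
        unfolding q_def diag_bilin_def
      proof (rule degree_sum_le)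
        fix i assume "i \<in> {..<n}"
        have "degree ([:c i:] * r i * r i) \<le> degree (r i) + degree (r i)"
          by (metis add_0 degree_mult_le degree_pCons_0 dual_order.trans mult.assoc)
        then show "degree ([:c i:] * r i * r i) \<le> 2 * (degree t - 1)" using dr[of i] by linarith
      qed simp
      then show ?thesis using dr[of j] by linarith
    qed
    then have "degree t' < degree t"
      unfolding qr using less.prems(1) t'0 by (simp add: degree_mult_eq)
    from less.hyps[OF this t'0] qv' show ?thesis unfolding q_def by blast
  qed
qed


section \<open>Pure quaternions over the function field of a conic\<close>

lemma diag_bilin_3: "diag_bilin 3 c u v = c 0 * u 0 * v 0 + c 1 * u 1 * v 1 + c 2 * u 2 * v 2"
  by (simp add: diag_bilin_def numeral_3_eq_3 numeral_2_eq_2)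

lemma
  assumes "field_hom \<epsilon>"
  shows field_hom_add: "\<epsilon> (x + y) = \<epsilon> x + \<epsilon> y"
    and field_hom_mult: "\<epsilon> (x * y) = \<epsilon> x * \<epsilon> y"
    and field_hom_1: "\<epsilon> 1 = 1"
    and field_hom_0: "\<epsilon> 0 = 0"
    and field_hom_minus: "\<epsilon> (- x) = - \<epsilon> x"
    and field_hom_diff: "\<epsilon> (x - y) = \<epsilon> x - \<epsilon> y"
    and field_hom_numeral: "\<epsilon> (numeral m) = numeral m"
    and field_hom_eq_0: "\<epsilon> x = 0 \<longleftrightarrow> x = 0"
proof -
  have add: "\<epsilon> (x + y) = \<epsilon> x + \<epsilon> y" and mult: "\<epsilon> (x * y) = \<epsilon> x * \<epsilon> y" and 1: "\<epsilon> 1 = 1" for x y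
    using assms by (auto simp: field_hom_def)
  have 0: "\<epsilon> 0 = 0" by (metis add add_0 add_cancel_right_right)
  have minus: "\<epsilon> (- x) = - \<epsilon> x" for x using add[of x "- x"] 0 by (simp add: eq_neg_iff_add_eq_0 add.commute)
  have diff: "\<epsilon> (x - y) = \<epsilon> x - \<epsilon> y" for x y using add[of x "- y"] minus[of y] by simp
  have eq0: "\<epsilon> x = 0 \<longleftrightarrow> x = 0" for x using mult[of x "inverse x"] 0 1 by (cases "x = 0") auto
  show "\<epsilon> (x + y) = \<epsilon> x + \<epsilon> y" "\<epsilon> (x * y) = \<epsilon> x * \<epsilon> y" "\<epsilon> 1 = 1" "\<epsilon> 0 = 0" "\<epsilon> (- x) = - \<epsilon> x"
    "\<epsilon> (x - y) = \<epsilon> x - \<epsilon> y" "\<epsilon> x = 0 \<longleftrightarrow> x = 0"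
    by (fact add mult 1 0 minus diff eq0)+
  show "\<epsilon> (numeral m) = numeral m"
    by (induction m) (simp_all only: numeral.simps add 1)
qed

lemmas field_hom_simps =
  field_hom_add field_hom_mult field_hom_1 field_hom_0 field_hom_minus field_hom_diff
  field_hom_numeral field_hom_eq_0

text \<open>The squares of \<open>i\<close>, \<open>j\<close> and \<open>ij\<close> in
  \<open>(c,d)\<close>.\<close>

definition pure_form :: "'r::comm_ring_1 \<Rightarrow> 'r \<Rightarrow> nat \<Rightarrow> 'r" where
  "pure_form c d i = (if i = 0 then c else if i = 1 then d else - (c * d))"

text \<open>\<open>(x, y)\<close> is the generic point of the conic: the locale fixes the witnesses
  hidden in \<open>conic_function_field\<close>.\<close>

locale conic_point =
  fixes a b :: "'f::field" and \<epsilon> :: "'f \<Rightarrow> 'k::field" and x y :: 'k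
  assumes two: "(2 :: 'f) \<noteq> 0" and a0: "a \<noteq> 0" and b0: "b \<noteq> 0"
    and hom: "field_hom \<epsilon>"
    and kernel: "eval2 \<epsilon> x y p = 0 \<longleftrightarrow> conic_poly a b dvd p"
    and generates: "\<exists>p q. eval2 \<epsilon> x y q \<noteq> 0 \<and> z = eval2 \<epsilon> x y p / eval2 \<epsilon> x y q"
begin

section \<open>Evaluation at the generic point and the normal form
  \<open>(u + v y) / t\<close>\<close>

lemmas hom_simps = field_hom_simps[OF hom]

definition ev :: "'f poly \<Rightarrow> 'k" where
  "ev p = poly (map_poly \<epsilon> p) x"

lemma ev_pCons: "ev (pCons c p) = \<epsilon> c + x * ev p"
  by (simp add: ev_def map_poly_pCons hom_simps)

lemma ev_0: "ev 0 = 0"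
  by (simp add: ev_def)

lemma ev_const: "ev [:c:] = \<epsilon> c"
  by (simp add: ev_pCons ev_0)

lemma ev_1: "ev 1 = 1"
  by (simp add: one_pCons ev_const hom_simps)

lemma ev_add: "ev (p + q) = ev p + ev q"
  by (induction p q rule: poly_induct2) (simp_all add: ev_0 ev_pCons hom_simps algebra_simps)

lemma ev_smult: "ev (smult c p) = \<epsilon> c * ev p"
  by (induction p) (simp_all add: ev_0 ev_pCons hom_simps algebra_simps)

lemma ev_mult: "ev (p * q) = ev p * ev q"
  by (induction p) (simp_all add: ev_0 ev_pCons ev_add ev_smult hom_simps algebra_simps)

lemma ev_minus: "ev (- p) = - ev p"
  using ev_smult[of "- 1" p] by (simp add: hom_simps)

lemma ev_diff: "ev (p - q) = ev p - ev q"
  using ev_add[of p "- q"] by (simp add: ev_minus)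

lemmas ev_simps = ev_0 ev_1 ev_const ev_smult ev_add ev_mult ev_minus ev_diff

lemma eval2_pCons: "eval2 \<epsilon> x y (pCons p P) = ev p + y * eval2 \<epsilon> x y P"
  by (simp add: eval2_def map_poly_pCons ev_def)

lemma eval2_0: "eval2 \<epsilon> x y 0 = 0"
  by (simp add: eval2_def)

lemma curve_eq: "\<epsilon> b * (y * y) = ev [:1, 0, - a:]"
proof -
  have "eval2 \<epsilon> x y (conic_poly a b) = 0" by (simp add: kernel)
  then show ?thesis
    by (simp add: conic_poly_def eval2_pCons eval2_0 ev_pCons ev_0 hom_simps algebra_simps)
qed

lemma curve_eq': "\<epsilon> a * (x * x) + \<epsilon> b * (y * y) = 1"
  unfolding curve_eq by (simp add: ev_pCons ev_0 hom_simps algebra_simps)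

text \<open>Since \<open>b\<close> is invertible, the curve equation turns \<open>y^2\<close> into a
  polynomial in \<open>x\<close>, so Horner's scheme in \<open>Y\<close> never leaves the
  \<open>F[x]\<close>-span of 1 and \<open>y\<close>.\<close>

lemma eval2_linear: "\<exists>u v. eval2 \<epsilon> x y p = ev u + ev v * y"
proof (induction p)
  case 0
  show ?case by (rule exI[of _ 0], rule exI[of _ 0]) (simp add: eval2_0 ev_0)
next
  case (pCons u0 P)
  then obtain u v where uv: "eval2 \<epsilon> x y P = ev u + ev v * y" by blast
  have yy: "y * y = ev ([:1, 0, - a:] * [:inverse b:])"
  proof -
    have "ev ([:1, 0, - a:] * [:inverse b:]) = \<epsilon> (b * inverse b) * (y * y)"
      unfolding ev_mult ev_const curve_eq[symmetric] hom_simps by (simp add: ac_simps)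
    then show ?thesis using b0 by (simp add: hom_simps)
  qed
  have "eval2 \<epsilon> x y (pCons u0 P) = ev (u0 + v * ([:1, 0, - a:] * [:inverse b:])) + ev u * y"
    unfolding eval2_pCons uv ev_add ev_mult[of v] yy[symmetric] by (simp add: algebra_simps)
  then show ?case by blast
qed

text \<open>A nonzero multiple of \<open>conic_poly a b\<close> has degree at least 2 in
  \<open>Y\<close>. This is what later allows comparing the coefficients of 1 and
  \<open>y\<close>.\<close>

lemma ev_linear_eq_0:
  assumes "ev u + ev v * y = 0"
  shows "u = 0" "v = 0"
proof -
  have "eval2 \<epsilon> x y [:u, v:] = 0"
    using assms by (simp add: eval2_pCons eval2_0 mult.commute)
  then have dvd: "conic_poly a b dvd [:u, v:]" by (simp add: kernel)
  have "degree (conic_poly a b) = 2" using b0 by (simp add: conic_poly_def)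
  moreover have "degree [:u, v:] \<le> 1" by simp
  ultimately have "[:u, v:] = 0"
    using dvd_imp_degree_le[OF dvd] by linarith
  then show "u = 0" "v = 0" by auto
qed

lemma ev_eq_0: "ev u = 0 \<longleftrightarrow> u = 0"
  using ev_linear_eq_0(1)[of u 0] by (auto simp: ev_0)

text \<open>Numerator and denominator are multiplied by \<open>b\<close> and by the conjugate
  \<open>q0 - q1 y\<close> of the denominator.\<close>

lemma rationalize_denominator: "\<exists>u v t. t \<noteq> 0 \<and> z * ev t = ev u + ev v * y"
proof -
  obtain p q where pq: "eval2 \<epsilon> x y q \<noteq> 0" "z = eval2 \<epsilon> x y p / eval2 \<epsilon> x y q"
    using generates by blast
  obtain p0 p1 where p: "eval2 \<epsilon> x y p = ev p0 + ev p1 * y" using eval2_linear by blast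
  obtain q0 q1 where q: "eval2 \<epsilon> x y q = ev q0 + ev q1 * y" using eval2_linear by blast
  have q01: "ev q0 + ev q1 * y \<noteq> 0" using pq(1) q by simp
  have z: "z * (ev q0 + ev q1 * y) = ev p0 + ev p1 * y" using pq p q by simp
  \<comment> \<open>By \<open>curve_eq\<close>, \<open>h\<close> evaluates to
    \<open>\<epsilon> b * y^2\<close>; \<open>t\<close> is \<open>b\<close> times the norm of
    \<open>q0 + q1 y\<close>.\<close>
  define h where "h = [:1, 0, - a:]"
  define t where "t = [:b:] * q0 * q0 - h * q1 * q1"
  have ev_t: "ev t = \<epsilon> b * (ev q0 - ev q1 * y) * (ev q0 + ev q1 * y)"
  proof -
    have "ev t = \<epsilon> b * ev q0 * ev q0 - (\<epsilon> b * (y * y)) * ev q1 * ev q1"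
      unfolding t_def curve_eq h_def[symmetric] by (simp add: ev_simps)
    then show ?thesis by (simp add: algebra_simps)
  qed
  have "ev q0 - ev q1 * y \<noteq> 0"
    using ev_linear_eq_0[of q0 "- q1"] q01 by (auto simp: ev_simps)
  then have "t \<noteq> 0" using ev_t q01 b0 by (auto simp: ev_0 hom_simps)
  moreover have "z * ev t = ev ([:b:] * p0 * q0 - h * p1 * q1) + ev ([:b:] * (p1 * q0 - p0 * q1)) * y"
  proof -
    have "z * ev t = \<epsilon> b * (ev q0 - ev q1 * y) * (ev p0 + ev p1 * y)"
      unfolding ev_t z[symmetric] by (simp add: algebra_simps)
    also have "\<dots> = \<epsilon> b * ev p0 * ev q0 - (\<epsilon> b * (y * y)) * ev p1 * ev q1
        + \<epsilon> b * (ev p1 * ev q0 - ev p0 * ev q1) * y"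
      by (simp add: algebra_simps)
    finally show ?thesis unfolding curve_eq h_def[symmetric] by (simp add: ev_simps algebra_simps)
  qed
  ultimately show ?thesis by blast
qed

lemma common_denominator:
  "\<exists>u v t. t \<noteq> 0 \<and> (\<forall>i<(n::nat). z i * ev t = ev (u i) + ev (v i) * y)"
proof (induction n)
  case 0
  show ?case using one_neq_zero by blast
next
  case (Suc n)
  then obtain u v t where t: "t \<noteq> 0" and uv: "\<And>i. i < n \<Longrightarrow> z i * ev t = ev (u i) + ev (v i) * y"
    by blast
  obtain u' v' t' where t': "t' \<noteq> 0" and uv': "z n * ev t' = ev u' + ev v' * y"
    using rationalize_denominator by blast
  have "z i * ev (t * t') = ev (if i = n then u' * t else u i * t') + ev (if i = n then v' * t else v i * t') * y"
    if "i < Suc n" for i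
  proof (cases "i = n")
    case True
    have "z i * ev (t * t') = (z n * ev t') * ev t" using True by (simp add: ev_mult)
    then show ?thesis unfolding uv' using True by (simp add: ev_mult algebra_simps)
  next
    case False
    have "z i * ev (t * t') = (z i * ev t) * ev t'" by (simp add: ev_mult)
    then show ?thesis using uv[of i] False that by (simp add: ev_mult algebra_simps)
  qed
  then show ?case using t t' by (intro exI[of _ "t * t'"]
        exI[of _ "\<lambda>i. if i = n then u' * t else u i * t'"]
        exI[of _ "\<lambda>i. if i = n then v' * t else v i * t'"]) auto
qed

text \<open>Squaring \<open>(u + v y) / t\<close> and comparing coefficients of \<open>y\<close>
  gives \<open>u v = 0\<close>. For \<open>v = 0\<close> the leading coefficients yield the root;
  \<open>u = 0\<close> with \<open>\<mu> \<noteq> 0\<close> would make \<open>1 - a X^2\<close> a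
  constant times a square of a linear polynomial, which its missing middle term excludes in
  characteristic not 2.\<close>

lemma square_descends:
  assumes "\<kappa> * \<kappa> = \<epsilon> \<mu>"
  shows "\<exists>\<nu>. \<nu> * \<nu> = \<mu>"
proof -
  obtain u v t where t: "t \<noteq> 0" and \<kappa>: "\<kappa> * ev t = ev u + ev v * y"
    using rationalize_denominator by blast
  define h where "h = [:1, 0, - a:]"
  have "\<epsilon> b * \<epsilon> \<mu> * ev t * ev t = \<epsilon> b * (\<kappa> * ev t) * (\<kappa> * ev t)"
    by (simp add: assms[symmetric] algebra_simps)
  also have "\<dots> = \<epsilon> b * ev u * ev u + (\<epsilon> b * (y * y)) * ev v * ev v + 2 * \<epsilon> b * ev u * ev v * y"
    unfolding \<kappa> by (simp add: algebra_simps)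
  finally have "ev ([:b:] * u * u + h * v * v - [:b * \<mu>:] * t * t) + ev ([:2 * b:] * u * v) * y = 0"
    unfolding curve_eq h_def[symmetric] ev_simps hom_simps by (simp add: algebra_simps)
  from ev_linear_eq_0[OF this]
  have eq: "[:b:] * u * u + h * v * v = [:b * \<mu>:] * t * t" and "[:2 * b:] * u * v = 0" by auto
  then have "u = 0 \<or> v = 0" using two b0 by (metis mult_eq_0_iff pCons_eq_0_iff)
  then show ?thesis
  proof
    assume "v = 0"
    have "[:b:] * (u * u) = [:b:] * ([:\<mu>:] * (t * t))"
    proof -
      have "[:b * \<mu>:] * t * t = [:b:] * ([:\<mu>:] * (t * t))" by (simp add: mult.commute)
      then show ?thesis using eq \<open>v = 0\<close> by (simp add: mult.assoc)
    qed
    then have "u * u = [:\<mu>:] * (t * t)" using b0 by (metis mult_left_cancel pCons_eq_0_iff)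
    then have "lead_coeff (u * u) = lead_coeff ([:\<mu>:] * (t * t))" by (simp add: mult.commute)
    then have "lead_coeff u * lead_coeff u = \<mu> * (lead_coeff t * lead_coeff t)"
      by (simp only: lead_coeff_mult) simp
    then have "(lead_coeff u / lead_coeff t) * (lead_coeff u / lead_coeff t) = \<mu>"
      using t by (simp add: field_simps)
    then show ?thesis by blast
  next
    assume "u = 0"
    show ?thesis
    proof (cases "v = 0 \<or> \<mu> = 0")
      case True
      then have "\<mu> = 0" using eq t b0 \<open>u = 0\<close> by auto
      then show ?thesis by (intro exI[of _ 0]) simp
    next
      case False
      \<comment> \<open>Here \<open>t\<close> plays the vector and \<open>v\<close> the denominator:
        \<open>h = b \<mu> (t / v)^2\<close> over \<open>F(X)\<close>.\<close>
      have "anisotropic 1 (\<lambda>_. b * \<mu>)"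
        using False b0 by (simp add: anisotropic_def diag_bilin_def)
      moreover have "diag_bilin 1 (\<lambda>i. [:b * \<mu>:]) (\<lambda>_. t) (\<lambda>_. t) = h * (v * v)"
        using eq \<open>u = 0\<close> by (simp add: diag_bilin_def mult.assoc)
      ultimately obtain w where "diag_bilin 1 (\<lambda>i. [:b * \<mu>:]) w w = h"
        using cassels_pfister[of 1 "\<lambda>_. b * \<mu>" v "\<lambda>_. t" h] False by blast
      then have w: "[:b * \<mu>:] * (w 0 * w 0) = h" by (simp add: diag_bilin_def mult.assoc)
      have w0: "w 0 \<noteq> 0" using w by (auto simp: h_def)
      have "2 * degree (w 0) = degree h"
        using b0 False w0 unfolding w[symmetric] by (simp add: degree_mult_eq)
      then have "degree (w 0) = 1" using a0 by (simp add: h_def)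
      then obtain p q where pq: "w 0 = [:p, q:]"
        by (metis One_nat_def degree1_coeffs)
      \<comment> \<open>The outer coefficients make \<open>p\<close> and \<open>q\<close> nonzero,
        against the middle one.\<close>
      have "b * \<mu> * (p * p) = 1" "2 * (b * \<mu> * (p * q)) = 0" "b * \<mu> * (q * q) = - a"
        using w unfolding pq h_def by (simp_all add: algebra_simps)
      then have False using two a0 by (metis mult_eq_0_iff neg_equal_0_iff_equal zero_neq_one)
      then show ?thesis ..
    qed
  qed
qed

text \<open>
  \<open>\<langle>c, d, -cd\<rangle>\<close> is the form \<open>q \<mapsto> q\<^sup>2\<close> on the pure quaternions of \<open>(c,d)\<close>. If
  \<open>(u + v y)\<^sup>2 = t\<^sup>2\<close> with pure quaternions \<open>u, v\<close> over \<open>F[x]\<close>, then \<open>w = (t - u) v\<close> is pure with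
  \<open>w\<^sup>2 = (v\<^sup>2)\<^sup>2 y\<^sup>2\<close>, so that \<open>\<langle>c, d, -cd\<rangle>\<close> represents \<open>b\<^sup>2 y\<^sup>2 = b - a b x\<^sup>2\<close> over \<open>F(x)\<close>.
\<close>

lemma pure_form_represents:
  assumes an: "anisotropic 3 (pure_form c d)"
    and z: "diag_bilin 3 (\<lambda>i. \<epsilon> (pure_form c d i)) z z = 1"
  shows "(\<exists>w. diag_bilin 3 (pure_form c d) w w = 1) \<or>
         (\<exists>v w. diag_bilin 3 (pure_form c d) v v = b \<and> diag_bilin 3 (pure_form c d) w w = - (a * b) \<and>
                diag_bilin 3 (pure_form c d) v w = 0)"
proof -
  define q where "q = diag_bilin 3 (\<lambda>i. [:pure_form c d i:])"
  define h where "h = [:1, 0, - a:]"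
  obtain u v t where t: "t \<noteq> 0" and uv: "\<And>i. i < 3 \<Longrightarrow> z i * ev t = ev (u i) + ev (v i) * y"
    using common_denominator[of 3 z] by blast
  have uv: "z 0 * ev t = ev (u 0) + ev (v 0) * y" "z 1 * ev t = ev (u 1) + ev (v 1) * y"
    "z 2 * ev t = ev (u 2) + ev (v 2) * y" by (simp_all add: uv)
  have ev_q: "ev (q u v) = diag_bilin 3 (\<lambda>i. \<epsilon> (pure_form c d i)) (\<lambda>i. ev (u i)) (\<lambda>i. ev (v i))" for u v
    by (simp add: q_def diag_bilin_3 ev_simps mult.assoc)
  \<comment> \<open>The equation \<open>q(z) = 1\<close> is multiplied by \<open>b t^2\<close> and
    expanded in \<open>u + v y\<close>, with \<open>h\<close> in place of \<open>b y^2\<close>; the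
    coefficients of 1 and \<open>y\<close> then vanish separately.\<close>
  have "\<epsilon> b * (ev t * ev t) =
      \<epsilon> b * diag_bilin 3 (\<lambda>i. \<epsilon> (pure_form c d i)) (\<lambda>i. z i * ev t) (\<lambda>i. z i * ev t)"
  proof -
    have "diag_bilin 3 (\<lambda>i. \<epsilon> (pure_form c d i)) (\<lambda>i. z i * ev t) (\<lambda>i. z i * ev t) =
        diag_bilin 3 (\<lambda>i. \<epsilon> (pure_form c d i)) z z * (ev t * ev t)"
      by (simp add: diag_bilin_3 algebra_simps)
    then show ?thesis by (simp add: z)
  qed
  also have "\<dots> = \<epsilon> b * ev (q u u) + (\<epsilon> b * (y * y)) * ev (q v v) + 2 * \<epsilon> b * ev (q u v) * y"
    unfolding ev_q diag_bilin_3 uv by (simp add: algebra_simps)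
  finally have "ev ([:b:] * q u u + h * q v v - [:b:] * (t * t)) + ev ([:2 * b:] * q u v) * y = 0"
    unfolding curve_eq h_def ev_simps hom_simps by (simp add: algebra_simps)
  from ev_linear_eq_0[OF this]
  have eq: "[:b:] * q u u + h * q v v = [:b:] * (t * t)" and "[:2 * b:] * q u v = 0" by auto
  then have orth: "q u v = 0" using two b0 by (metis mult_eq_0_iff pCons_eq_0_iff)
  show ?thesis
  proof (cases "\<forall>i<3. v i = 0")
    case True
    then have "q v v = 0" by (simp add: q_def diag_bilin_3)
    then have "[:b:] * q u u = [:b:] * (t * t)" using eq by simp
    then have "q u u = 1 * (t * t)" using b0 by (simp add: smult_eq_iff)
    then obtain w where w: "q w w = 1"
      using cassels_pfister[OF an t] unfolding q_def by blast
    \<comment> \<open>By the degree bound \<open>w\<close> is constant, so its constant terms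
      represent 1 over \<open>F\<close>.\<close>
    have "coeff (q w w) (2 * 0) = diag_bilin 3 (pure_form c d) (\<lambda>i. coeff (w i) 0) (\<lambda>i. coeff (w i) 0)"
      unfolding q_def
    proof (rule coeff_diag_bilin)
      fix i :: nat assume "i < 3"
      then show "degree (w i) \<le> 0"
        using anisotropic_poly(2)[of 3 "pure_form c d" i w i] an w
        by (cases "w i = 0") (auto simp: q_def)
    qed
    then show ?thesis using w by auto
  next
    case False
    then obtain j where j: "j < 3" "v j \<noteq> 0" by blast
    have qv: "q v v \<noteq> 0" using anisotropic_poly(1)[of 3 "pure_form c d" j v] an j unfolding q_def by blast
    \<comment> \<open>\<open>b\<close> times the pure part of \<open>(t - u) v\<close>, whose scalar
      part \<open>- q u v\<close> is 0. The factor \<open>b\<close> brings in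
      \<open>b t^2 - b q(u) = h q(v)\<close>.\<close>
    define w where "w = (\<lambda>i. [:b:] * (if i = 0 then t * v 0 + [:d:] * (u 1 * v 2 - u 2 * v 1)
       else if i = (1::nat) then t * v 1 - [:c:] * (u 0 * v 2 - u 2 * v 0)
       else t * v 2 - (u 0 * v 1 - u 1 * v 0)))"
    have q3: "q u' v' = [:c:] * u' 0 * v' 0 + [:d:] * u' 1 * v' 1 - [:c:] * [:d:] * u' 2 * v' 2" for u' v'
      unfolding q_def diag_bilin_3 pure_form_def by (simp add: mult.commute)
    \<comment> \<open>Multiplicativity of the quaternion norm; with the term in \<open>q u v\<close>
      kept, it is a polynomial identity.\<close>
    have "q w w = [:b:] * ([:b:] * (q v v * (t * t - q u u) + q u v * q u v))"
      unfolding q3 w_def by (simp del: mult_pCons_left mult_pCons_right, algebra)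
    also have "\<dots> = [:b:] * (q v v * ([:b:] * (t * t) - [:b:] * q u u))"
      unfolding orth by (simp del: mult_pCons_left mult_pCons_right add: algebra_simps)
    also have "[:b:] * (t * t) - [:b:] * q u u = h * q v v" using eq by (simp add: algebra_simps)
    finally have "q w w = ([:b:] * h) * (q v v * q v v)" by (simp add: algebra_simps)
    \<comment> \<open>Cassels-Pfister with denominator \<open>q v v\<close>; as \<open>b h\<close>
      has degree at most 2, the new \<open>w\<close> has degree at most 1.\<close>
    then obtain w where w: "q w w = [:b:] * h"
      using cassels_pfister[OF an qv] unfolding q_def by blast
    have deg: "degree (w i) \<le> 1" if "i < 3" for i
    proof (cases "w i = 0")
      case False
      then have "2 * degree (w i) \<le> degree ([:b:] * h)"
        using anisotropic_poly(2)[of 3 "pure_form c d" i w i] an w that unfolding q_def by simp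
      moreover have "degree ([:b:] * h) \<le> 2" by (simp add: h_def)
      ultimately show ?thesis by linarith
    qed simp
    have w_eq: "w i = [:coeff (w i) 0, coeff (w i) 1:]" if "i < 3" for i
      using deg[OF that] by (intro poly_eqI) (auto simp: coeff_pCons coeff_eq_0 split: nat.splits)
    define v0 where "v0 = (\<lambda>i. coeff (w i) 0)"
    define v1 where "v1 = (\<lambda>i. coeff (w i) 1)"
    have ws: "w 0 = [:v0 0, v1 0:]" "w 1 = [:v0 1, v1 1:]" "w 2 = [:v0 2, v1 2:]"
      unfolding v0_def v1_def by (rule w_eq; simp)+
    define q0 where "q0 = diag_bilin 3 (pure_form c d)"
    have "q w w = [:q0 v0 v0, 2 * q0 v0 v1, q0 v1 v1:]"
      unfolding q_def q0_def diag_bilin_3 ws by (simp add: algebra_simps)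
    moreover have "q w w = [:b, 0, - (a * b):]" using w by (simp add: h_def mult.commute)
    ultimately have "[:q0 v0 v0, 2 * q0 v0 v1, q0 v1 v1:] = [:b, 0, - (a * b):]" by metis
    then have "q0 v0 v0 = b" "2 * q0 v0 v1 = 0" "q0 v1 v1 = - (a * b)" by simp_all
    then show ?thesis using two unfolding q0_def by auto
  qed
qed

end


section \<open>Universal property of scalar extension\<close>

lemma lookup_free_scale: "Poly_Mapping.lookup (free_scale k p) x = k * Poly_Mapping.lookup p x"
  by (simp add: free_scale_def Poly_Mapping.map.rep_eq when_def)

lemma module_free_scale: "module (free_scale :: 'k::field \<Rightarrow> ('a \<Rightarrow>\<^sub>0 'k) \<Rightarrow> _)"
  by unfold_locales
    (auto intro!: poly_mapping_eqI simp: lookup_free_scale lookup_add algebra_simps)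

lemma sum_keys_add:
  fixes g :: "'a \<Rightarrow> 'k::ab_group_add \<Rightarrow> 'w::ab_group_add"
  assumes "\<And>x k l. g x (k + l) = g x k + g x l"
  shows "(\<Sum>x\<in>Poly_Mapping.keys (p + q). g x (Poly_Mapping.lookup (p + q) x)) =
    (\<Sum>x\<in>Poly_Mapping.keys p. g x (Poly_Mapping.lookup p x)) + (\<Sum>x\<in>Poly_Mapping.keys q. g x (Poly_Mapping.lookup q x))"
  using assms assms[of _ 0 0] by (intro setsum_keys_plus_distrib) auto

lemma sum_keys_single:
  assumes "g x (0 :: 'k::zero) = (0 :: 'w::comm_monoid_add)"
  shows "(\<Sum>y\<in>Poly_Mapping.keys (Poly_Mapping.single x k). g y (Poly_Mapping.lookup (Poly_Mapping.single x k) y)) = g x k"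
  using assms by (cases "k = 0") auto

context assoc_algebra
begin

lemma mul_zero_left: "mul 0 x = 0"
  using mul_add_left[of 0 0 x] by simp

lemma mul_zero_right: "mul x 0 = 0"
  using mul_add_right[of x 0 0] by simp

lemma mul_minus_left: "mul (- x) y = - mul x y"
  using mul_add_left[of x "- x" y] by (simp add: mul_zero_left eq_neg_iff_add_eq_0 add.commute)

lemma mul_minus_right: "mul x (- y) = - mul x y"
  using mul_add_right[of x y "- y"] by (simp add: mul_zero_right eq_neg_iff_add_eq_0 add.commute)

lemma mul_diff_left: "mul (x - y) z = mul x z - mul y z"
  using mul_add_left[of x "- y" z] by (simp add: mul_minus_left)

lemma mul_diff_right: "mul x (y - z) = mul x y - mul x z"
  using mul_add_right[of x y "- z"] by (simp add: mul_minus_right)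

end

text \<open>Products are parameters because the locale serves both rings and matrices, whose product
  is \<open>**\<close>.\<close>

locale base_change =
  fixes scl :: "'f::field \<Rightarrow> 'a::ab_group_add \<Rightarrow> 'a" and mul one
    and \<epsilon> :: "'f \<Rightarrow> 'k::field"
    and scaleK :: "'k \<Rightarrow> 'b::ab_group_add \<Rightarrow> 'b" and mulK oneK and \<iota> :: "'a \<Rightarrow> 'b"
  assumes alg: "assoc_algebra scl mul one"
    and ext: "scalar_extension scl mul one \<epsilon> scaleK mulK oneK \<iota>"
begin

sublocale A: assoc_algebra scl mul one by (rule alg)

sublocale B: assoc_algebra scaleK mulK oneK
  using ext by (simp add: scalar_extension_def)

sublocale free: module "free_scale :: 'k \<Rightarrow> ('a \<Rightarrow>\<^sub>0 'k) \<Rightarrow> _"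
  by (rule module_free_scale)

lemma hom: "field_hom \<epsilon>"
  and \<iota>_mul: "\<iota> (mul x y) = mulK (\<iota> x) (\<iota> y)"
  and \<iota>_one: "\<iota> one = oneK"
  and surj_tensor_eval: "range (tensor_eval scaleK \<iota>) = UNIV"
  and kernel: "tensor_eval scaleK \<iota> p = 0 \<longleftrightarrow> p \<in> module.span free_scale (tensor_relations scl \<epsilon>)"
  using ext by (auto simp: scalar_extension_def)

lemmas hom_simps = field_hom_simps[OF hom]

lemma tensor_eval_add: "tensor_eval scaleK \<iota> (p + q) = tensor_eval scaleK \<iota> p + tensor_eval scaleK \<iota> q"
  unfolding tensor_eval_def by (rule sum_keys_add) (rule B.scale_left_distrib)

lemma tensor_eval_minus: "tensor_eval scaleK \<iota> (- p) = - tensor_eval scaleK \<iota> p"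
proof -
  have "tensor_eval scaleK \<iota> 0 = 0" by (simp add: tensor_eval_def)
  then show ?thesis using tensor_eval_add[of p "- p"] by (simp add: eq_neg_iff_add_eq_0 add.commute)
qed

lemma tensor_eval_diff: "tensor_eval scaleK \<iota> (p - q) = tensor_eval scaleK \<iota> p - tensor_eval scaleK \<iota> q"
  using tensor_eval_add[of p "- q"] by (simp add: tensor_eval_minus)

lemma tensor_eval_single: "tensor_eval scaleK \<iota> (Poly_Mapping.single x k) = scaleK k (\<iota> x)"
  unfolding tensor_eval_def by (rule sum_keys_single[where g = "\<lambda>x k. scaleK k (\<iota> x)"]) simp

lemma \<iota>_add: "\<iota> (x + y) = \<iota> x + \<iota> y"
proof -
  have "Poly_Mapping.single (x + y) 1 - Poly_Mapping.single x 1 - Poly_Mapping.single y 1 \<in> tensor_relations scl \<epsilon>"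
    by (auto simp: tensor_relations_def)
  from free.span_base[OF this] show ?thesis
    unfolding kernel[symmetric] by (simp add: tensor_eval_diff tensor_eval_single tensor_eval_add diff_diff_eq)
qed

lemma \<iota>_scale: "\<iota> (scl c x) = scaleK (\<epsilon> c) (\<iota> x)"
proof -
  have "Poly_Mapping.single (scl c x) 1 - Poly_Mapping.single x (\<epsilon> c) \<in> tensor_relations scl \<epsilon>"
    by (auto simp: tensor_relations_def)
  from free.span_base[OF this] show ?thesis
    unfolding kernel[symmetric] by (simp add: tensor_eval_diff tensor_eval_single)
qed

lemma \<iota>_0: "\<iota> 0 = 0" using \<iota>_add[of 0 0] by simp

lemma \<iota>_minus: "\<iota> (- x) = - \<iota> x"
  using \<iota>_add[of x "- x"] by (simp add: \<iota>_0 eq_neg_iff_add_eq_0 add.commute)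

lemma \<iota>_diff: "\<iota> (x - y) = \<iota> x - \<iota> y"
  using \<iota>_add[of x "- y"] by (simp add: \<iota>_minus)

text \<open>\<open>A \<otimes> K\<close> consists of sums of pure tensors; the empty sum is the pure
  tensor with \<open>k = 0\<close>.\<close>

lemma base_change_induct [case_names scale add]:
  assumes "\<And>k x. P (scaleK k (\<iota> x))" and "\<And>x y. P x \<Longrightarrow> P y \<Longrightarrow> P (x + y)"
  shows "P b"
proof -
  obtain p where b: "b = tensor_eval scaleK \<iota> p" using surj_tensor_eval by (metis rangeE UNIV_I)
  have "P (\<Sum>x\<in>S. scaleK (Poly_Mapping.lookup p x) (\<iota> x))" if "finite S" for S
    using that
  proof (induction S)
    case empty
    show ?case using assms(1)[of 0 0] by simp
  qed (auto intro: assms)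
  then show ?thesis unfolding b tensor_eval_def by simp
qed

text \<open>A balanced biadditive map extends to the free space and kills the relations, whose span
  is the kernel of \<open>tensor_eval\<close>. The target is merely a group, because
  \<open>descent_map\<close> needs a map into the \<open>F\<close>-space \<open>A\<close>.\<close>

lemma universal_property:
  fixes h :: "'a \<Rightarrow> 'k \<Rightarrow> 'w::ab_group_add"
  assumes add_left: "\<And>x y k. h (x + y) k = h x k + h y k"
    and add_right: "\<And>x k l. h x (k + l) = h x k + h x l"
    and balanced: "\<And>c x k. h (scl c x) k = h x (\<epsilon> c * k)"
  shows "\<exists>H. (\<forall>u v. H (u + v) = H u + H v) \<and> (\<forall>k x. H (scaleK k (\<iota> x)) = h x k)"
proof -
  have h0: "h x 0 = 0" for x using add_right[of x 0 0] by simp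
  define T where "T p = (\<Sum>x\<in>Poly_Mapping.keys p. h x (Poly_Mapping.lookup p x))" for p
  have T_add: "T (p + q) = T p + T q" for p q
    unfolding T_def by (rule sum_keys_add) (rule add_right)
  have T_0: "T 0 = 0" by (simp add: T_def)
  have T_minus: "T (- p) = - T p" for p
    using T_add[of p "- p"] T_0 by (simp add: eq_neg_iff_add_eq_0 add.commute)
  have T_diff: "T (p - q) = T p - T q" for p q
    using T_add[of p "- q"] T_minus by simp
  have T_single: "T (Poly_Mapping.single x k) = h x k" for x k
    unfolding T_def by (rule sum_keys_single) (rule h0)
  have scale_single: "free_scale k (Poly_Mapping.single x l) = Poly_Mapping.single x (k * l)" for k l :: 'k and x :: 'a
    by (intro poly_mapping_eqI) (simp add: lookup_free_scale lookup_single when_def)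
  \<comment> \<open>The kernel is a \<open>K\<close>-span while \<open>T\<close> is only additive,
    hence the claim for all multiples of \<open>p\<close>.\<close>
  have "\<forall>k. T (free_scale k p) = 0" if "p \<in> module.span free_scale (tensor_relations scl \<epsilon>)" for p
    using that
  proof (induction rule: free.span_induct_alt)
    case base
    then show ?case by (simp add: T_0)
  next
    case (step c r q)
    have "T (free_scale k r) = 0" for k
      using step(1) unfolding tensor_relations_def
      by (auto simp: free.scale_right_diff_distrib scale_single T_diff T_single add_left balanced mult.commute)
    then show ?case using step by (simp add: free.scale_right_distrib T_add)
  qed
  then have ker: "T p = 0" if "tensor_eval scaleK \<iota> p = 0" for p
    using that kernel by (metis free.scale_one)
  have wd: "T p = T q" if "tensor_eval scaleK \<iota> p = tensor_eval scaleK \<iota> q" for p q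
    using ker[of "p - q"] that by (simp add: T_diff tensor_eval_diff)
  define H where "H b = T (SOME p. tensor_eval scaleK \<iota> p = b)" for b
  have H: "H (tensor_eval scaleK \<iota> p) = T p" for p
    unfolding H_def by (rule wd) (rule someI_ex, blast)
  have "H (u + v) = H u + H v" for u v
    using surj_tensor_eval by (metis H T_add tensor_eval_add rangeE UNIV_I)
  moreover have "H (scaleK k (\<iota> x)) = h x k" for k x
    unfolding tensor_eval_single[symmetric] H T_single ..
  ultimately show ?thesis by blast
qed

lemma extend_linear_map:
  assumes "Vector_Spaces.linear scl scl g"
  shows "\<exists>G. extended_map scaleK \<iota> g G"
proof -
  interpret g: Vector_Spaces.linear scl scl g by (rule assms)
  obtain G where G: "\<And>u v. G (u + v) = G u + G v" "\<And>k x. G (scaleK k (\<iota> x)) = scaleK k (\<iota> (g x))"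
    using universal_property[of "\<lambda>x k. scaleK k (\<iota> (g x))"]
    by (auto simp: g.add g.scale \<iota>_add \<iota>_scale B.scale_right_distrib B.scale_left_distrib mult.commute)
  have "G (scaleK c u) = scaleK c (G u)" for c u
    by (induction u rule: base_change_induct) (simp_all add: G B.scale_right_distrib)
  moreover have "G (\<iota> x) = \<iota> (g x)" for x using G(2)[of 1] by simp
  ultimately show ?thesis
    unfolding extended_map_def Vector_Spaces.linear_iff using G(1) B.vector_space_axioms by blast
qed

lemma extend_functional:
  assumes "Vector_Spaces.linear scl (*) g"
  shows "\<exists>G. Vector_Spaces.linear scaleK (*) G \<and> (\<forall>x. G (\<iota> x) = \<epsilon> (g x))"
proof -
  interpret g: Vector_Spaces.linear scl "(*)" g by (rule assms)
  obtain G where G: "\<And>u v. G (u + v) = G u + G v" "\<And>k x. G (scaleK k (\<iota> x)) = k * \<epsilon> (g x)"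
    using universal_property[of "\<lambda>x k. k * \<epsilon> (g x)"]
    by (auto simp: g.add g.scale hom_simps algebra_simps)
  have "G (scaleK c u) = c * G u" for c u
    by (induction u rule: base_change_induct) (simp_all add: G algebra_simps)
  moreover have "G (\<iota> x) = \<epsilon> (g x)" for x using G(2)[of 1] by simp
  moreover have "vector_space ((*) :: 'k \<Rightarrow> _)" by unfold_locales (auto simp: algebra_simps)
  ultimately show ?thesis
    unfolding Vector_Spaces.linear_iff using G(1) B.vector_space_axioms by blast
qed

end

section \<open>Linear functionals and injectivity of
  \<open>x \<mapsto> x \<otimes> 1\<close>\<close>

lemma (in vector_space) functional_nonzero:
  assumes "v \<noteq> 0"
  shows "\<exists>g. Vector_Spaces.linear scale (*) g \<and> g v = 1"
proof -
  define E where "E = extend_basis {v}"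
  have ind: "independent {v}" using assms by (simp add: dependent_single)
  have E: "independent E" "span E = UNIV" "v \<in> E"
    unfolding E_def using ind independent_extend_basis span_extend_basis extend_basis_superset by blast+
  have "vector_space ((*) :: 'a \<Rightarrow> _)" by unfold_locales (auto simp: algebra_simps)
  then have "Vector_Spaces.linear scale (*) (\<lambda>x. representation E x v)"
    unfolding Vector_Spaces.linear_iff using E
    by (auto simp: representation_add representation_scale intro: vector_space_axioms)
  moreover have "representation E v v = 1" using E by (simp add: representation_basis)
  ultimately show ?thesis by blast
qed

context base_change
begin

text \<open>The coordinates in a finite basis \<open>E\<close> of \<open>A\<close> extend to
  \<open>A \<otimes> K\<close>, where every \<open>M\<close> is recovered from them; so some
  extended coordinate of \<open>M \<noteq> 0\<close> is nonzero.\<close>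

lemma functional_separates:
  assumes fin: "\<exists>B. finite B \<and> A.span B = UNIV" and "M \<noteq> 0"
  shows "\<exists>g G. Vector_Spaces.linear scl (*) g \<and> Vector_Spaces.linear scaleK (*) G \<and>
    (\<forall>x. G (\<iota> x) = \<epsilon> (g x)) \<and> G M \<noteq> 0"
proof -
  obtain E where E: "finite E" "A.independent E" "A.span E = UNIV"
  proof -
    obtain B where B: "finite B" "A.span B = UNIV" using fin by blast
    obtain E where E: "E \<subseteq> B" "A.independent E" "B \<subseteq> A.span E"
      using A.maximal_independent_subset[of B] by blast
    have "A.span B \<subseteq> A.span E" by (rule A.span_minimal[OF E(3) A.subspace_span])
    then have "A.span E = UNIV" using B(2) by auto
    then show ?thesis using that[OF finite_subset[OF E(1) B(1)] E(2)] by simp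
  qed
  define g where "g e x = A.representation E x e" for e x
  have "vector_space ((*) :: 'f \<Rightarrow> _)" by unfold_locales (auto simp: algebra_simps)
  then have g: "Vector_Spaces.linear scl (*) (g e)" for e
    unfolding Vector_Spaces.linear_iff g_def using E
    by (auto simp: A.representation_add A.representation_scale intro: A.vector_space_axioms)
  then obtain G where G: "\<And>e. Vector_Spaces.linear scaleK (*) (G e)" "\<And>e x. G e (\<iota> x) = \<epsilon> (g e x)"
    using extend_functional[OF g] by metis
  have lin: "G e (u + v) = G e u + G e v" "G e (scaleK c u) = c * G e u" for e u v c
    using G(1)[of e] by (auto simp: Vector_Spaces.linear_iff)
  have \<iota>_sum: "\<iota> (\<Sum>e\<in>S. f e) = (\<Sum>e\<in>S. \<iota> (f e))" if "finite S" for S and f :: "'a \<Rightarrow> 'a"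
    using that by (induction S) (simp_all add: \<iota>_0 \<iota>_add)
  have "(\<Sum>e\<in>E. scaleK (G e u) (\<iota> e)) = u" for u
  proof (induction u rule: base_change_induct)
    case (scale k x)
    have "\<iota> x = \<iota> (\<Sum>e\<in>E. scl (g e x) e)"
      unfolding g_def using E by (subst A.sum_representation_eq) auto
    also have "\<dots> = (\<Sum>e\<in>E. scaleK (\<epsilon> (g e x)) (\<iota> e))"
      using E(1) by (simp add: \<iota>_sum \<iota>_scale)
    finally have "(\<Sum>e\<in>E. scaleK k (scaleK (\<epsilon> (g e x)) (\<iota> e))) = scaleK k (\<iota> x)"
      by (simp add: B.scale_sum_right)
    then show ?case by (simp add: lin G(2))
  next
    case (add u v)
    then show ?case by (simp add: lin B.scale_left_distrib sum.distrib)
  qed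
  then have "(\<Sum>e\<in>E. scaleK (G e M) (\<iota> e)) \<noteq> 0" using \<open>M \<noteq> 0\<close> by simp
  then obtain e where "scaleK (G e M) (\<iota> e) \<noteq> 0" using sum.not_neutral_contains_not_neutral by blast
  then have "G e M \<noteq> 0" by auto
  then show ?thesis using g G by blast
qed

text \<open>A functional with value 1 at \<open>x\<close> extends to \<open>A \<otimes> K\<close>,
  and the extension is 1 at \<open>\<iota> x\<close>.\<close>

lemma \<iota>_eq_0: "\<iota> x = 0 \<longleftrightarrow> x = 0"
proof
  assume "\<iota> x = 0"
  show "x = 0"
  proof (rule ccontr)
    assume "x \<noteq> 0"
    then obtain g where g: "Vector_Spaces.linear scl (*) g" "g x = 1" using A.functional_nonzero by blast
    then obtain G where "Vector_Spaces.linear scaleK (*) G" "\<And>x. G (\<iota> x) = \<epsilon> (g x)"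
      using extend_functional by blast
    then show False using \<open>\<iota> x = 0\<close> g(2) by (metis Vector_Spaces.linear.axioms(3) field_hom_1[OF hom] linear_0 module_hom.zero zero_neq_one)
  qed
qed (simp add: \<iota>_0)

lemma \<iota>_eq: "\<iota> x = \<iota> y \<longleftrightarrow> x = y"
  using \<iota>_eq_0[of "x - y"] by (auto simp: \<iota>_diff)

end


section \<open>Skew-symmetric elements in the split case\<close>

lemma matrix_assoc_algebra:
  "assoc_algebra (mat_scale :: 'l::field \<Rightarrow> 'l^'n^'n \<Rightarrow> _) (**) (mat 1)"
proof (unfold_locales)
  fix X Y Z :: "'l^'n^'n" and c :: 'l
  show "(X ** Y) ** Z = X ** (Y ** Z)" by (simp add: matrix_mul_assoc)
  show "(X + Y) ** Z = X ** Z + Y ** Z"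
    by (simp add: vec_eq_iff matrix_matrix_mult_def sum.distrib algebra_simps)
  show "X ** (Y + Z) = X ** Y + X ** Z" by (rule matrix_add_ldistrib)
  show "mat_scale c X ** Y = mat_scale c (X ** Y)" "X ** mat_scale c Y = mat_scale c (X ** Y)"
    by (simp_all add: vec_eq_iff matrix_matrix_mult_def mat_scale_def sum_distrib_left algebra_simps)
qed (simp_all add: mat_scale_def vec_eq_iff algebra_simps)

interpretation mat_alg: assoc_algebra "mat_scale :: 'l::field \<Rightarrow> 'l^'n^'n \<Rightarrow> _" "(**)" "mat 1"
  by (rule matrix_assoc_algebra)

section \<open>Alternating matrices and the Pfaffian adjoint\<close>

definition mat_unit :: "'n::finite \<Rightarrow> 'n \<Rightarrow> 'l::field^'n^'n" where
  "mat_unit k l = (\<chi> i j. if i = k \<and> j = l then 1 else 0)"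

lemma mat_unit_mult:
  "(A ** mat_unit k l) $ m $ n = (if n = l then A $ m $ k else 0)"
  "(mat_unit k l ** A) $ m $ n = (if m = k then A $ l $ n else 0)"
  unfolding mat_unit_def matrix_matrix_mult_def
  by (auto simp: if_distrib if_distribR sum.delta' cong: if_cong)

lemma transpose_mat_unit: "transpose (mat_unit k l) = mat_unit l k"
  by (auto simp: transpose_def mat_unit_def vec_eq_iff)

text \<open>For an alternating matrix \<open>R\<close> of size \<open>4\<close>, \<open>R ** pf_adj R\<close> is the scalar \<open>- pf R\<close>.\<close>

definition pf_adj :: "'l::field^4^4 \<Rightarrow> 'l^4^4" where
  "pf_adj R = (\<chi> i j.
     if (i, j) = (1, 2) then R $ 3 $ 4 else if (i, j) = (2, 1) then - R $ 3 $ 4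
     else if (i, j) = (1, 3) then - R $ 2 $ 4 else if (i, j) = (3, 1) then R $ 2 $ 4
     else if (i, j) = (1, 4) then R $ 2 $ 3 else if (i, j) = (4, 1) then - R $ 2 $ 3
     else if (i, j) = (2, 3) then R $ 1 $ 4 else if (i, j) = (3, 2) then - R $ 1 $ 4
     else if (i, j) = (2, 4) then - R $ 1 $ 3 else if (i, j) = (4, 2) then R $ 1 $ 3
     else if (i, j) = (3, 4) then R $ 1 $ 2 else if (i, j) = (4, 3) then - R $ 1 $ 2
     else 0)"

lemma pf_adj_simps:
  "pf_adj (R + S) = pf_adj R + pf_adj S"
  "pf_adj (mat_scale k R) = mat_scale k (pf_adj R)"
  "transpose (pf_adj R) = - pf_adj R"
  by (simp_all add: pf_adj_def mat_scale_def transpose_def vec_eq_iff forall_4)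

lemma alternatingD:
  fixes R :: "'l::field^'n^'n"
  assumes "(2 :: 'l) \<noteq> 0" "transpose R = - R"
  shows "R $ j $ i = - R $ i $ j" "R $ i $ i = 0"
proof -
  have *: "R $ j $ i = - R $ i $ j" for i j
    using arg_cong[OF assms(2), of "\<lambda>M. M $ i $ j"] by (simp add: transpose_def)
  then show "R $ j $ i = - R $ i $ j" .
  have "2 * R $ i $ i = 0" using *[of i i] by (metis add.right_inverse mult_2)
  then show "R $ i $ i = 0" using assms(1) by simp
qed

lemma mult_pf_adj:
  fixes R :: "'l::field^4^4"
  assumes "(2 :: 'l) \<noteq> 0" "transpose R = - R"
  shows "\<exists>k. R ** pf_adj R = mat_scale k (mat 1)"
proof -
  note R = alternatingD[OF assms]
  have R': "R $ 2 $ 1 = - R $ 1 $ 2" "R $ 3 $ 1 = - R $ 1 $ 3" "R $ 4 $ 1 = - R $ 1 $ 4"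
    "R $ 3 $ 2 = - R $ 2 $ 3" "R $ 4 $ 2 = - R $ 2 $ 4" "R $ 4 $ 3 = - R $ 3 $ 4"
    by (rule R)+
  have "R ** pf_adj R =
      mat_scale (R $ 1 $ 3 * R $ 2 $ 4 - R $ 1 $ 2 * R $ 3 $ 4 - R $ 1 $ 4 * R $ 2 $ 3) (mat 1)"
    by (simp add: vec_eq_iff forall_4 matrix_matrix_mult_def sum_4 pf_adj_def mat_scale_def mat_def
        R(2) R' algebra_simps)
  then show ?thesis ..
qed

lemma pf_adj_eq_0:
  fixes R :: "'l::field^4^4"
  assumes "(2 :: 'l) \<noteq> 0" "transpose R = - R" "pf_adj R = 0"
  shows "R = 0"
proof -
  note R = alternatingD[OF assms(1,2)]
  have R': "R $ 2 $ 1 = - R $ 1 $ 2" "R $ 3 $ 1 = - R $ 1 $ 3" "R $ 4 $ 1 = - R $ 1 $ 4"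
    "R $ 3 $ 2 = - R $ 2 $ 3" "R $ 4 $ 2 = - R $ 2 $ 4" "R $ 4 $ 3 = - R $ 3 $ 4"
    by (rule R)+
  show ?thesis using assms(3) by (simp add: vec_eq_iff forall_4 pf_adj_def R(2) R')
qed

text \<open>For \<open>Y = E_kl\<close> the entry \<open>(l, k)\<close> of the sandwich is
  \<open>R_lk^2 - R_ll R_kk\<close>, and an alternating matrix has zero diagonal.\<close>

lemma alternating_sandwich_eq_0:
  fixes R :: "'l::field^'n^'n"
  assumes "(2 :: 'l) \<noteq> 0" "transpose R = - R"
    and 0: "\<And>Y. R ** (Y - transpose Y) ** R = 0"
  shows "R = 0"
proof -
  have "R $ l $ k = 0" for k l
  proof -
    have "(R ** mat_unit k l ** R) $ l $ k = R $ l $ k * R $ l $ k"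
      "(R ** mat_unit l k ** R) $ l $ k = R $ l $ l * R $ k $ k"
      unfolding matrix_matrix_mult_def[of "R ** _"]
      by (auto simp: mat_unit_mult if_distrib if_distribR sum.delta' cong: if_cong)
    moreover have "(R ** mat_unit k l ** R) $ l $ k = (R ** mat_unit l k ** R) $ l $ k"
    proof -
      have "R ** mat_unit k l ** R = R ** (mat_unit k l - mat_unit l k) ** R + R ** mat_unit l k ** R"
        by (simp flip: mat_alg.mul_add_left mat_alg.mul_add_right)
      then show ?thesis using 0[of "mat_unit k l"] by (simp add: transpose_mat_unit)
    qed
    ultimately show ?thesis using alternatingD(2)[OF assms(1,2)] by simp
  qed
  then show ?thesis by (simp add: vec_eq_iff)
qed

lemma ex_index_4: "\<exists>l::4. l \<noteq> m \<and> l \<noteq> k"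
proof -
  have "\<not> (\<forall>l::4. l = m \<or> l = k)" unfolding forall_4 by auto
  then show ?thesis by blast
qed

text \<open>Tested on \<open>E_kl - E_lk\<close>, the condition kills each off-diagonal entry with
  the help of a third index and gives \<open>U_kk = - U_ll\<close> for distinct indices; a cycle of
  three indices then makes \<open>U_kk\<close> its own negative.\<close>

lemma commutes_alternating_eq_0:
  fixes U :: "'l::field^4^4"
  assumes two: "(2 :: 'l) \<noteq> 0"
    and comm: "\<And>Y. U ** (Y - transpose Y) = - ((Y - transpose Y) ** transpose U)"
  shows "U = 0"
proof -
  have eq: "(if n = l then U $ m $ k else 0) - (if n = k then U $ m $ l else 0) =
      (if m = l then U $ n $ k else 0) - (if m = k then U $ n $ l else 0)" for k l m n
  proof -
    have "U ** mat_unit k l - U ** mat_unit l k = mat_unit l k ** transpose U - mat_unit k l ** transpose U"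
      using comm[of "mat_unit k l"]
      by (simp add: transpose_mat_unit mat_alg.mul_diff_left mat_alg.mul_diff_right)
    from arg_cong[OF this, of "\<lambda>M. M $ m $ n"] show ?thesis
      by (simp add: mat_unit_mult transpose_def)
  qed
  have off: "U $ m $ k = 0" if "m \<noteq> k" for m k
  proof -
    obtain l where "l \<noteq> m" "l \<noteq> k" using ex_index_4[of m k] by blast
    then show ?thesis using eq[of l l m k] that by simp
  qed
  have diag: "U $ k $ k = - U $ l $ l" if "k \<noteq> l" for k l
    using eq[of l l k k] that by simp
  have "U $ k $ k = 0" for k
  proof -
    obtain l m where "l \<noteq> m" "l \<noteq> k" "m \<noteq> k" using ex_index_4[of k k] ex_index_4[of _ k] by metis
    then have "U $ k $ k = - U $ k $ k" using diag[of k l] diag[of l m] diag[of m k] by simp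
    then have "2 * U $ k $ k = 0" by (metis add.right_inverse mult_2)
    then show ?thesis using two by simp
  qed
  with off have "U $ i $ j = 0" for i j by (cases "i = j") auto
  then show ?thesis by (simp add: vec_eq_iff)
qed

text \<open>This is \<open>id \<otimes> f\<close>, which leads from \<open>A \<otimes> K\<close>
  back to \<open>A\<close>.\<close>

lemma (in base_change) descent_map:
  assumes "Vector_Spaces.linear (\<lambda>c l. \<epsilon> c * l) (*) f"
  shows "\<exists>D. (\<forall>u v. D (u + v) = D u + D v) \<and> (\<forall>k x. D (scaleK k (\<iota> x)) = scl (f k) x)"
  using assms by (intro universal_property)
    (auto simp: Vector_Spaces.linear_iff A.scale_right_distrib A.scale_left_distrib mult.commute)

section \<open>Orthogonal involutions of degree 4 over a splitting field\<close>

locale split_orthogonal = base_change scl "(*)" 1 \<epsilon> mat_scale "(**)" "mat 1" \<phi>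
  for scl :: "'f::field \<Rightarrow> 'a::ring_1 \<Rightarrow> 'a" and \<epsilon> :: "'f \<Rightarrow> 'l::field" and \<phi> :: "'a \<Rightarrow> 'l^4^4" +
  fixes \<sigma> :: "'a \<Rightarrow> 'a" and \<tau> :: "'l^4^4 \<Rightarrow> 'l^4^4" and \<beta> :: "'l^4 \<Rightarrow> 'l^4 \<Rightarrow> 'l"
  assumes two: "(2 :: 'f) \<noteq> 0"
    and finite_dim: "\<exists>B. finite B \<and> A.span B = UNIV"
    and inv: "involution scl (*) \<sigma>"
    and extended: "extended_map mat_scale \<phi> \<sigma> \<tau>"
    and form: "symmetric_nondegenerate_form \<beta>"
    and adjoint: "\<beta> (M *v v) w = \<beta> v (\<tau> M *v w)"
begin

lemma two_L: "(2 :: 'l) \<noteq> 0"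
  using two hom_simps(7,8) by metis

lemma \<sigma>_add: "\<sigma> (x + y) = \<sigma> x + \<sigma> y" and \<sigma>_scale: "\<sigma> (scl c x) = scl c (\<sigma> x)"
  and \<sigma>_\<sigma>: "\<sigma> (\<sigma> x) = x"
  using inv by (auto simp: involution_def Vector_Spaces.linear_iff)

lemma \<sigma>_diff: "\<sigma> (x - y) = \<sigma> x - \<sigma> y"
  using \<sigma>_add[of "x - y" y] by (simp add: algebra_simps)

lemma \<tau>_add: "\<tau> (X + Y) = \<tau> X + \<tau> Y" and \<tau>_scale: "\<tau> (mat_scale c X) = mat_scale c (\<tau> X)"
  and \<tau>_\<phi>: "\<tau> (\<phi> x) = \<phi> (\<sigma> x)"
  using extended by (auto simp: extended_map_def Vector_Spaces.linear_iff)

definition Gram :: "'l^4^4" where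
  "Gram = (\<chi> i j. \<beta> (axis i 1) (axis j 1))"

lemma form_expand: "\<beta> v w = (\<Sum>k\<in>UNIV. w $ k * \<beta> v (axis k 1))"
proof -
  have lin: "\<beta> v (x + y) = \<beta> v x + \<beta> v y" "\<beta> v (c *s x) = c * \<beta> v x" for x y c
    using form by (auto simp: symmetric_nondegenerate_form_def Vector_Spaces.linear_iff)
  have 0: "\<beta> v 0 = 0" using lin(2)[of 0] by simp
  have sum: "\<beta> v (\<Sum>k\<in>S. f k) = (\<Sum>k\<in>S. \<beta> v (f k))" if "finite S" for S :: "4 set" and f
    using that by (induction S) (simp_all add: lin 0)
  have "\<beta> v w = \<beta> v (\<Sum>k\<in>UNIV. w $ k *s axis k 1)" by (simp only: basis_expansion)
  then show ?thesis by (simp add: sum lin)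
qed

lemma form_sym: "\<beta> v w = \<beta> w v"
  using form by (simp add: symmetric_nondegenerate_form_def)

lemma transpose_Gram: "transpose Gram = Gram"
  by (simp add: Gram_def transpose_def vec_eq_iff form_sym)

lemma transpose_mult_Gram: "transpose M ** Gram = Gram ** \<tau> M"
proof -
  have col: "(N *v axis j 1) $ k = N $ k $ j" for N :: "'l^4^4" and j k
    by (simp add: matrix_vector_mult_def axis_def if_distrib cong: if_cong)
  have "(Gram ** \<tau> M) $ i $ j = (transpose M ** Gram) $ i $ j" for i j
  proof -
    have "(Gram ** \<tau> M) $ i $ j = \<beta> (axis i 1) (\<tau> M *v axis j 1)"
      by (subst form_expand) (simp add: col matrix_matrix_mult_def Gram_def mult.commute)
    also have "\<dots> = \<beta> (axis j 1) (M *v axis i 1)"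
      by (simp only: adjoint[symmetric] form_sym)
    also have "\<dots> = (transpose M ** Gram) $ i $ j"
      by (subst form_expand) (simp add: col matrix_matrix_mult_def Gram_def transpose_def form_sym)
    finally show ?thesis .
  qed
  then show ?thesis by (simp add: vec_eq_iff)
qed

lemma Gram_invertible: "\<exists>C. C ** Gram = mat 1 \<and> Gram ** C = mat 1"
proof -
  have "w = 0" if "Gram *v w = 0" for w
  proof -
    have "\<beta> (axis i 1) w = (Gram *v w) $ i" for i
      by (subst form_expand) (simp add: Gram_def matrix_vector_mult_def mult.commute)
    then have "\<beta> w v = 0" for v
      by (subst form_expand) (simp add: that form_sym)
    then show "w = 0" using form by (auto simp: symmetric_nondegenerate_form_def)
  qed
  then obtain C where "C ** Gram = mat 1"
    using matrix_left_invertible_ker[of Gram] by blast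
  then show ?thesis using matrix_left_right_inverse by blast
qed

text \<open>The inverse Gram matrix; right multiplication by it turns skew-symmetric elements into
  alternating matrices.\<close>

definition C :: "'l^4^4" where
  "C = (SOME C. C ** Gram = mat 1 \<and> Gram ** C = mat 1)"

lemma C_Gram: "C ** Gram = mat 1" and Gram_C: "Gram ** C = mat 1"
  using someI_ex[OF Gram_invertible] by (simp_all add: C_def)

lemma C_Gram_cancel: "C ** (Gram ** M) = M" "Gram ** (C ** M) = M"
  by (simp_all add: matrix_mul_assoc C_Gram Gram_C)

lemma transpose_C: "transpose C = C"
proof -
  have "transpose C ** Gram = mat 1"
    by (metis Gram_C matrix_transpose_mul transpose_Gram transpose_mat)
  then have "transpose C ** (Gram ** C) = C"
    by (simp add: matrix_mul_assoc)
  then show ?thesis by (simp add: Gram_C)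
qed

lemma \<tau>_eq: "\<tau> M = C ** (transpose M ** Gram)"
  by (simp add: transpose_mult_Gram C_Gram_cancel)

text \<open>As \<open>C\<close> is symmetric and inverse to \<open>Gram\<close>,
  \<open>(M C)^T = C M^T = \<tau>(M) C\<close>.\<close>

lemma alternating_of_skew:
  assumes "\<sigma> r = - r"
  shows "transpose (\<phi> r ** C) = - (\<phi> r ** C)"
proof -
  have "transpose (\<phi> r ** C) = C ** (transpose (\<phi> r) ** Gram) ** C"
    by (simp add: matrix_transpose_mul transpose_C Gram_C flip: matrix_mul_assoc)
  also have "\<dots> = \<tau> (\<phi> r) ** C" by (simp add: \<tau>_eq)
  finally show ?thesis by (simp add: \<tau>_\<phi> assms \<iota>_minus mat_alg.mul_minus_left)
qed

text \<open>The skew-symmetric elements of \<open>A\<close> span those of \<open>M\<^sub>4(L)\<close>, which are the \<open>(Y - Y\<^sup>T) ** Gram\<close>.\<close>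

lemma skew_induct:
  assumes scale: "\<And>k x. \<sigma> x = - x \<Longrightarrow> P (mat_scale k (\<phi> x))"
    and add: "\<And>X Y. P X \<Longrightarrow> P Y \<Longrightarrow> P (X + Y)"
  shows "P ((Y - transpose Y) ** Gram)"
proof -
  have "P (M - \<tau> M)" for M
  proof (induction M rule: base_change_induct)
    case (scale k x)
    have "mat_scale k (\<phi> x) - \<tau> (mat_scale k (\<phi> x)) = mat_scale k (\<phi> (x - \<sigma> x))"
      by (simp add: \<tau>_scale \<tau>_\<phi> \<iota>_diff B.scale_right_diff_distrib)
    moreover have "\<sigma> (x - \<sigma> x) = - (x - \<sigma> x)"
      by (simp add: \<sigma>_diff \<sigma>_\<sigma>)
    ultimately show ?case using assms(1) by simp
  next
    case (add X Y)
    have "X + Y - \<tau> (X + Y) = (X - \<tau> X) + (Y - \<tau> Y)" by (simp add: \<tau>_add)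
    then show ?case using add assms(2) by metis
  qed
  moreover have "(Y - transpose Y) ** Gram = Y ** Gram - \<tau> (Y ** Gram)"
    by (simp add: \<tau>_eq matrix_transpose_mul transpose_Gram C_Gram_cancel mat_alg.mul_diff_left
        flip: matrix_mul_assoc)
  ultimately show ?thesis by metis
qed

text \<open>Writing \<open>\<phi> r = R Gram\<close> reduces this to
  \<open>alternating_sandwich_eq_0\<close>. It will show that a nonzero element of
  \<open>Plus\<close> with square 0 cannot anticommute with all of \<open>Plus\<close>.\<close>

lemma skew_sandwich_eq_0:
  assumes r: "\<sigma> r = - r" and 0: "\<And>x. \<sigma> x = - x \<Longrightarrow> r * x * r = 0"
  shows "r = 0"
proof -
  define R where "R = \<phi> r ** C"
  have \<phi>r: "\<phi> r = R ** Gram" by (simp add: R_def C_Gram flip: matrix_mul_assoc)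
  have "\<phi> r ** ((Y - transpose Y) ** Gram) ** \<phi> r = 0" for Y
  proof (rule skew_induct[where P = "\<lambda>M. \<phi> r ** M ** \<phi> r = 0"])
    fix k x assume "\<sigma> x = - x"
    then show "\<phi> r ** mat_scale k (\<phi> x) ** \<phi> r = 0"
      by (simp add: mat_alg.mul_scale_left mat_alg.mul_scale_right 0 \<iota>_0 flip: \<iota>_mul)
  qed (simp add: mat_alg.mul_add_left mat_alg.mul_add_right)
  from arg_cong[OF this, of "\<lambda>M. M ** C"]
  have *: "R ** (Gram ** (Y - transpose Y) ** Gram) ** R = 0" for Y
    by (simp add: \<phi>r Gram_C mat_alg.mul_zero_left flip: matrix_mul_assoc)
  have sandwich: "R ** (Y - transpose Y) ** R = 0" for Y
  proof -
    \<comment> \<open>Replacing \<open>Y\<close> by \<open>C Y C\<close> cancels the two Gram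
      factors.\<close>
    have "Gram ** (C ** Y ** C - transpose (C ** Y ** C)) ** Gram = Y - transpose Y"
      by (simp add: matrix_transpose_mul transpose_C mat_alg.mul_diff_left mat_alg.mul_diff_right
          C_Gram_cancel C_Gram flip: matrix_mul_assoc)
    then show ?thesis using *[of "C ** Y ** C"] by simp
  qed
  have "transpose R = - R" unfolding R_def by (rule alternating_of_skew[OF r])
  then have "R = 0" by (rule alternating_sandwich_eq_0[OF two_L _ sandwich])
  then have "\<phi> r = 0" by (simp add: \<phi>r mat_alg.mul_zero_left)
  then show ?thesis by (simp add: \<iota>_eq_0)
qed

text \<open>Skewness reads \<open>Gram \<phi>(r) = - \<phi>(r)^T Gram\<close>, which turns the
  commutation with all \<open>(Y - Y^T) Gram\<close> into the hypothesis of
  \<open>commutes_alternating_eq_0\<close>. It will show that no nonzero element of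
  \<open>Plus\<close> commutes with all of \<open>Plus\<close>.\<close>

lemma skew_central_eq_0:
  assumes r: "\<sigma> r = - r" and comm: "\<And>x. \<sigma> x = - x \<Longrightarrow> r * x = x * r"
  shows "r = 0"
proof -
  have *: "\<phi> r ** ((Y - transpose Y) ** Gram) = (Y - transpose Y) ** Gram ** \<phi> r" for Y
  proof (rule skew_induct[where P = "\<lambda>M. \<phi> r ** M = M ** \<phi> r"])
    fix k x assume "\<sigma> x = - x"
    then show "\<phi> r ** mat_scale k (\<phi> x) = mat_scale k (\<phi> x) ** \<phi> r"
      by (simp add: mat_alg.mul_scale_left mat_alg.mul_scale_right comm flip: \<iota>_mul)
  qed (simp add: mat_alg.mul_add_left mat_alg.mul_add_right)
  have tr: "Gram ** \<phi> r = - (transpose (\<phi> r) ** Gram)"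
    using transpose_mult_Gram[of "\<phi> r"] by (simp add: \<tau>_\<phi> r \<iota>_minus mat_alg.mul_minus_right)
  have "\<phi> r ** (Y - transpose Y) = - ((Y - transpose Y) ** transpose (\<phi> r))" for Y
  proof -
    have "\<phi> r ** (Y - transpose Y) ** Gram = - ((Y - transpose Y) ** transpose (\<phi> r)) ** Gram"
      using *[of Y] by (simp add: tr mat_alg.mul_minus_left mat_alg.mul_minus_right flip: matrix_mul_assoc)
    from arg_cong[OF this, of "\<lambda>M. M ** C"] show ?thesis
      by (simp add: Gram_C flip: matrix_mul_assoc)
  qed
  then have "\<phi> r = 0" by (rule commutes_alternating_eq_0[OF two_L])
  then show ?thesis by (simp add: \<iota>_eq_0)
qed

text \<open>
  Over \<open>L\<close> the required map is \<open>r \<mapsto> C ** pf_adj (r ** C)\<close>; applying an \<open>F\<close>-linear functional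
  \<open>f : L \<rightarrow> F\<close> to \<open>A \<otimes>\<^sub>F L\<close> brings it down to \<open>A\<close>.
\<close>

lemma pfaffian_adjoint_exists:
  assumes s: "\<sigma> s = - s" "s \<noteq> 0"
  shows "\<exists>p. Vector_Spaces.linear scl scl p \<and> (\<forall>r. \<sigma> r = - r \<longrightarrow> \<sigma> (p r) = - p r \<and> (\<exists>n. r * p r = scl n 1)) \<and> p s \<noteq> 0"
proof -
  define \<pi> where "\<pi> M = C ** pf_adj (M ** C)" for M
  have \<pi>_add: "\<pi> (X + Y) = \<pi> X + \<pi> Y" and \<pi>_scale: "\<pi> (mat_scale k X) = mat_scale k (\<pi> X)" for X Y k
    by (simp_all add: \<pi>_def pf_adj_simps mat_alg.mul_add_left mat_alg.mul_add_right
        mat_alg.mul_scale_left mat_alg.mul_scale_right)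
  \<comment> \<open>With \<open>R = \<phi> r ** C\<close> the product is
    \<open>R ** pf_adj R\<close>.\<close>
  have \<phi>_\<pi>: "\<exists>k. \<phi> r ** \<pi> (\<phi> r) = mat_scale k (mat 1)" if "\<sigma> r = - r" for r
    using mult_pf_adj[OF two_L alternating_of_skew[OF that]] by (simp add: \<pi>_def matrix_mul_assoc)
  have \<tau>_\<pi>: "\<tau> (\<pi> M) = - \<pi> M" for M
    by (simp add: \<tau>_eq \<pi>_def matrix_transpose_mul transpose_C pf_adj_simps C_Gram mat_alg.mul_minus_left
        mat_alg.mul_minus_right flip: matrix_mul_assoc)
  have "\<pi> (\<phi> s) \<noteq> 0"
  proof
    assume "\<pi> (\<phi> s) = 0"
    then have "Gram ** \<pi> (\<phi> s) = 0" by (simp add: mat_alg.mul_zero_right)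
    then have "pf_adj (\<phi> s ** C) = 0" by (simp add: \<pi>_def C_Gram_cancel)
    then have "\<phi> s ** C = 0" by (rule pf_adj_eq_0[OF two_L alternating_of_skew[OF s(1)]])
    then have "\<phi> s ** C ** Gram = 0" by (simp add: mat_alg.mul_zero_left)
    then show False using s(2) by (simp add: C_Gram \<iota>_eq_0 flip: matrix_mul_assoc)
  qed
  \<comment> \<open>\<open>g\<close> and \<open>f\<close> are chosen so that
    \<open>g (D (\<pi> (\<phi> s))) = f (G (\<pi> (\<phi> s))) = 1\<close> below, which keeps the
    image of \<open>s\<close> nonzero.\<close>
  then obtain g G where g: "Vector_Spaces.linear scl (*) g" and G: "Vector_Spaces.linear mat_scale (*) G"
    "\<And>x. G (\<phi> x) = \<epsilon> (g x)" "G (\<pi> (\<phi> s)) \<noteq> 0"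
    using functional_separates[OF finite_dim] by metis
  interpret L: vector_space "\<lambda>c l. \<epsilon> c * l"
    by unfold_locales (auto simp: hom_simps algebra_simps)
  obtain f where f: "Vector_Spaces.linear (\<lambda>c l. \<epsilon> c * l) (*) f" "f (G (\<pi> (\<phi> s))) = 1"
    using L.functional_nonzero[OF G(3)] by blast
  then obtain D where D_add: "\<And>u v. D (u + v) = D u + D v" and D: "\<And>k x. D (mat_scale k (\<phi> x)) = scl (f k) x"
    using descent_map by blast
  have f_lin: "f (k + l) = f k + f l" "f (\<epsilon> c * k) = c * f k" for k l c
    using f(1) by (auto simp: Vector_Spaces.linear_iff)
  have D_scale: "D (mat_scale (\<epsilon> c) M) = scl c (D M)" for c M
    by (induction M rule: base_change_induct)
      (simp_all add: D D_add f_lin A.scale_right_distrib B.scale_right_distrib)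
  \<comment> \<open>By left \<open>A\<close>-linearity, \<open>D\<close> sends the scalar
    \<open>\<phi> r ** \<pi> (\<phi> r)\<close> to \<open>r * D (\<pi> (\<phi> r))\<close>, which is
    thus a scalar over \<open>F\<close>.\<close>
  have D_\<phi>: "D (\<phi> a ** M) = a * D M" for a M
    by (induction M rule: base_change_induct)
      (simp_all add: D D_add mat_alg.mul_scale_right mat_alg.mul_add_right A.mul_scale_right distrib_left flip: \<iota>_mul)
  have D_\<tau>: "D (\<tau> M) = \<sigma> (D M)" for M
    by (induction M rule: base_change_induct) (simp_all add: D D_add \<tau>_scale \<tau>_\<phi> \<tau>_add \<sigma>_add \<sigma>_scale)
  have g_lin: "g (x + y) = g x + g y" "g (scl c x) = c * g x" for x y c
    using g by (auto simp: Vector_Spaces.linear_iff)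
  have G_lin: "G (X + Y) = G X + G Y" "G (mat_scale c X) = c * G X" for X Y c
    using G(1) by (auto simp: Vector_Spaces.linear_iff)
  \<comment> \<open>Both sides are \<open>g \<otimes> f\<close>.\<close>
  have D_G: "g (D M) = f (G M)" for M
  proof (induction M rule: base_change_induct)
    case (scale k x)
    have "f (k * \<epsilon> (g x)) = g x * f k" using f_lin(2)[of "g x" k] by (simp add: mult.commute)
    then show ?case by (simp add: D g_lin G_lin G(2) mult.commute)
  qed (simp add: D_add g_lin G_lin f_lin)
  have "D 0 = 0" using D_add[of 0 0] by simp
  then have D_minus: "D (- M) = - D M" for M
    using D_add[of M "- M"] by (simp add: eq_neg_iff_add_eq_0 add.commute)
  have "\<sigma> (D (\<pi> (\<phi> r))) = - D (\<pi> (\<phi> r))" for r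
    by (simp add: \<tau>_\<pi> D_minus flip: D_\<tau>)
  moreover have "\<exists>n. r * D (\<pi> (\<phi> r)) = scl n 1" if "\<sigma> r = - r" for r
    using \<phi>_\<pi>[OF that] by (metis D D_\<phi> \<iota>_one)
  moreover have "D (\<pi> (\<phi> s)) \<noteq> 0"
    using D_G[of "\<pi> (\<phi> s)"] f(2) g_lin(2)[of 0 0] by auto
  moreover have "Vector_Spaces.linear scl scl (\<lambda>r. D (\<pi> (\<phi> r)))"
    unfolding Vector_Spaces.linear_iff
    by (simp add: A.vector_space_axioms \<iota>_add \<iota>_scale \<pi>_add \<pi>_scale D_add D_scale)
  ultimately show ?thesis by blast
qed

end


section \<open>Involutions and quaternion subalgebras\<close>

locale involution_algebra = assoc_algebra scl "(*)" 1
  for scl :: "'f::field \<Rightarrow> 'a::ring_1 \<Rightarrow> 'a" +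
  fixes \<sigma> :: "'a \<Rightarrow> 'a"
  assumes two: "(2 :: 'f) \<noteq> 0" and inv: "involution scl (*) \<sigma>"
begin

lemma \<sigma>_add: "\<sigma> (x + y) = \<sigma> x + \<sigma> y" and \<sigma>_scale: "\<sigma> (scl c x) = scl c (\<sigma> x)"
  and \<sigma>_mult: "\<sigma> (x * y) = \<sigma> y * \<sigma> x" and \<sigma>_\<sigma>: "\<sigma> (\<sigma> x) = x"
  using inv by (auto simp: involution_def Vector_Spaces.linear_iff)

lemma \<sigma>_diff: "\<sigma> (x - y) = \<sigma> x - \<sigma> y"
  using \<sigma>_add[of "x - y" y] by (simp add: algebra_simps)

lemma \<sigma>_minus: "\<sigma> (- x) = - \<sigma> x"
  using \<sigma>_diff[of 0 x] \<sigma>_diff[of 0 0] by simp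

lemma \<sigma>_1: "\<sigma> 1 = 1"
proof -
  have "\<sigma> (\<sigma> 1 * 1) = \<sigma> 1 * 1" by (simp only: \<sigma>_mult \<sigma>_\<sigma>)
  then show ?thesis by (simp add: \<sigma>_\<sigma>)
qed

lemmas \<sigma>_simps = \<sigma>_add \<sigma>_diff \<sigma>_minus \<sigma>_scale \<sigma>_mult \<sigma>_\<sigma> \<sigma>_1

lemma scale_half_double: "scl (1 / 2) (x + x) = x"
  using two by (simp add: scale_right_distrib flip: scale_left_distrib)

lemma double_eq_0: fixes x :: 'a shows "x + x = 0 \<longleftrightarrow> x = 0"
  using scale_half_double[of x] by auto

lemma eq_minus_self: fixes x :: 'a shows "x = - x \<longleftrightarrow> x = 0"
  using double_eq_0[of x] by (simp add: eq_neg_iff_add_eq_0)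

lemma scale_one_eq: "scl c 1 = scl d 1 \<longleftrightarrow> c = d"
  by simp

text \<open>The idempotent \<open>e\<close> and \<open>s\<close> determine each other by
  \<open>s = 2 e - 1\<close>.\<close>

lemma hyperbolic_iff: "hyperbolic (*) 1 \<sigma> \<longleftrightarrow> (\<exists>s. \<sigma> s = - s \<and> s * s = 1)"
proof
  assume "hyperbolic (*) 1 \<sigma>"
  then obtain e where e: "e * e = e" "\<sigma> e = 1 - e" by (auto simp: hyperbolic_def)
  have "\<sigma> (e + e - 1) = - (e + e - 1)" by (simp add: \<sigma>_simps e)
  moreover have "(e + e - 1) * (e + e - 1) = 1" by (simp add: algebra_simps e)
  ultimately show "\<exists>s. \<sigma> s = - s \<and> s * s = 1" by blast
next
  assume "\<exists>s. \<sigma> s = - s \<and> s * s = 1"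
  then obtain s where s: "\<sigma> s = - s" "s * s = 1" by blast
  define e where "e = scl (1 / 2) (1 + s)"
  have "(1 + s) * (1 + s) = (1 + s) + (1 + s)" by (simp add: algebra_simps s)
  then have "e * e = e"
    by (simp add: e_def mul_scale_left mul_scale_right scale_half_double del: scale_scale)
  moreover have "\<sigma> e = 1 - e"
  proof -
    have "\<sigma> e + e = scl (1 / 2) ((1 + 1))"
      unfolding e_def \<sigma>_scale scale_right_distrib[symmetric] by (simp add: \<sigma>_simps s)
    then show ?thesis by (simp only: scale_half_double) (simp add: algebra_simps)
  qed
  ultimately show "hyperbolic (*) 1 \<sigma>" by (auto simp: hyperbolic_def)
qed

section \<open>Quaternion subalgebras stable under the involution\<close>

definition pure_element :: "'a \<Rightarrow> 'a \<Rightarrow> (nat \<Rightarrow> 'f) \<Rightarrow> 'a" where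
  "pure_element e f u = scl (u 0) e + scl (u 1) f + scl (u 2) (e * f)"

text \<open>\<open>e\<close>, \<open>f\<close> and \<open>e f\<close> anticommute pairwise and have
  squares \<open>c\<close>, \<open>d\<close> and \<open>- c d\<close>, so only diagonal terms
  survive.\<close>

lemma pure_element_mult:
  assumes "e * e = scl c 1" "f * f = scl d 1" "f * e = - (e * f)"
  shows "pure_element e f u * pure_element e f v + pure_element e f v * pure_element e f u =
    scl (2 * diag_bilin 3 (pure_form c d) u v) 1"
proof -
  have rules: "e * (e * z) = scl c z" "f * (f * z) = scl d z" "f * (e * z) = - (e * (f * z))" for z
    using assms by (simp_all add: mul_scale_left flip: mult.assoc)
  define g where "g = e * f"
  have expand: "pure_element e f u * pure_element e f v + pure_element e f v * pure_element e f u =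
      scl (u 0 * v 0) (e * e + e * e) + scl (u 1 * v 1) (f * f + f * f) + scl (u 2 * v 2) (g * g + g * g) +
      scl (u 0 * v 1 + u 1 * v 0) (e * f + f * e) + scl (u 0 * v 2 + u 2 * v 0) (e * g + g * e) +
      scl (u 1 * v 2 + u 2 * v 1) (f * g + g * f)"
    unfolding pure_element_def g_def[symmetric] distrib_left distrib_right mul_scale_left mul_scale_right
      scale_scale scale_right_distrib scale_left_distrib by (simp add: ac_simps)
  have rel: "e * f + f * e = 0" "e * g + g * e = 0" "f * g + g * f = 0" "g * g = scl (- (c * d)) 1"
    by (simp_all add: g_def assms rules mult.assoc mult.commute[of d c])
  have double: "scl k (scl l 1 + scl l 1) = scl (2 * (k * l)) 1" for k l
    by (simp add: algebra_simps flip: scale_left_distrib)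
  have "pure_element e f u * pure_element e f v + pure_element e f v * pure_element e f u =
      scl (2 * (u 0 * v 0 * c)) 1 + scl (2 * (u 1 * v 1 * d)) 1 + scl (2 * (u 2 * v 2 * - (c * d))) 1"
    unfolding expand rel assms(1,2) double by simp
  also have "\<dots> = scl (2 * diag_bilin 3 (pure_form c d) u v) 1"
    unfolding diag_bilin_3 pure_form_def scale_left_distrib[symmetric]
    by (simp add: algebra_simps)
  finally show ?thesis .
qed

lemma pure_element_square:
  assumes "e * e = scl c 1" "f * f = scl d 1" "f * e = - (e * f)"
  shows "pure_element e f u * pure_element e f u = scl (diag_bilin 3 (pure_form c d) u u) 1"
proof -
  have "pure_element e f u * pure_element e f u = scl (1 / 2) (scl (2 * diag_bilin 3 (pure_form c d) u u) 1)"
    by (simp only: pure_element_mult[OF assms, symmetric] scale_half_double)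
  then show ?thesis using two by simp
qed

text \<open>Conjugation by \<open>u\<close> absorbs the inner automorphism: \<open>\<psi>\<close>
  carries the canonical involution itself to \<open>\<sigma>\<close>, and \<open>I\<close>,
  \<open>J\<close> are the images of \<open>i\<close>, \<open>j\<close>.\<close>

lemma containsD:
  assumes "contains_with_involution scl (*) 1 \<sigma> quat_scale (quat_mul a b) quat_one quat_conj"
  shows "\<exists>I J. \<sigma> I = - I \<and> \<sigma> J = - J \<and> I * I = scl a 1 \<and> J * J = scl b 1 \<and> I * J = - (J * I)"
proof -
  interpret Q: assoc_algebra quat_scale "quat_mul a b" quat_one by (rule quat_assoc_algebra)
  obtain \<phi> u v where \<phi>: "algebra_hom quat_scale (quat_mul a b) quat_one scl (*) 1 \<phi>"
    and uv: "quat_mul a b u v = quat_one" "quat_mul a b v u = quat_one"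
    and \<sigma>\<phi>: "\<And>x. \<sigma> (\<phi> x) = \<phi> (quat_mul a b u (quat_mul a b (quat_conj (quat_mul a b v (quat_mul a b x u))) v))"
    using assms unfolding contains_with_involution_def by blast
  have hom: "\<phi> (x + y) = \<phi> x + \<phi> y" "\<phi> (quat_scale c x) = scl c (\<phi> x)"
    "\<phi> (quat_mul a b x y) = \<phi> x * \<phi> y" "\<phi> quat_one = 1" for x y c
    using \<phi> unfolding algebra_hom_def Vector_Spaces.linear_iff by blast+
  have \<phi>_minus: "\<phi> (- x) = - \<phi> x" for x
    using hom(1)[of x "- x"] hom(1)[of 0 0] by (simp add: eq_neg_iff_add_eq_0 add.commute)
  define \<psi> where "\<psi> z = \<phi> (quat_mul a b u (quat_mul a b z v))" for z
  have vu: "quat_mul a b v (quat_mul a b u z) = z" for z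
    by (simp add: uv Q.mul_one_left flip: Q.mul_assoc)
  have \<psi>_mul: "\<psi> (quat_mul a b y z) = \<psi> y * \<psi> z" for y z
    by (simp add: \<psi>_def vu Q.mul_assoc flip: hom(3))
  have \<psi>_scale: "\<psi> (quat_scale c quat_one) = scl c 1" for c
    by (simp add: \<psi>_def Q.mul_scale_left Q.mul_scale_right Q.mul_one_left uv hom)
  have \<psi>_minus: "\<psi> (- z) = - \<psi> z" for z
    by (simp add: \<psi>_def Q.mul_minus_left Q.mul_minus_right \<phi>_minus)
  have \<psi>_\<sigma>: "\<sigma> (\<psi> z) = \<psi> (quat_conj z)" for z
    unfolding \<psi>_def \<sigma>\<phi> by (simp add: Q.mul_assoc uv vu Q.mul_one_right)
  define I J :: "'f quat" where "I = (0, 1, 0, 0)" and "J = (0, 0, 1, 0)"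
  have "quat_conj I = - I" "quat_conj J = - J" "quat_mul a b I I = quat_scale a quat_one"
    "quat_mul a b J J = quat_scale b quat_one" "quat_mul a b I J = - quat_mul a b J I"
    by (simp_all add: I_def J_def quat_conj_def quat_mul_def quat_scale_def quat_one_def)
  then have "\<sigma> (\<psi> I) = - \<psi> I" "\<sigma> (\<psi> J) = - \<psi> J" "\<psi> I * \<psi> I = scl a 1" "\<psi> J * \<psi> J = scl b 1"
    "\<psi> I * \<psi> J = - (\<psi> J * \<psi> I)"
    by (simp_all add: \<psi>_\<sigma> \<psi>_minus \<psi>_scale flip: \<psi>_mul)
  then show ?thesis by blast
qed

lemma containsI:
  assumes ab: "a \<noteq> 0" "b \<noteq> 0"
    and IJ: "\<sigma> I = - I" "\<sigma> J = - J" "I * I = scl a 1" "J * J = scl b 1" "J * I = - (I * J)"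
  shows "contains_with_involution scl (*) 1 \<sigma> quat_scale (quat_mul a b) quat_one quat_conj"
proof -
  interpret Q: assoc_algebra quat_scale "quat_mul a b" quat_one by (rule quat_assoc_algebra)
  define \<phi> where "\<phi> = (\<lambda>(x0, x1, x2, x3). scl x0 1 + scl x1 I + scl x2 J + scl x3 (I * J))"
  have IJ': "I * (I * z) = scl a z" "J * (J * z) = scl b z" "J * (I * z) = - (I * (J * z))" for z
    by (simp_all add: IJ mul_scale_left flip: mult.assoc)
  note simps = mul_scale_left mul_scale_right distrib_left distrib_right mult.assoc IJ IJ'
    scale_right_distrib scale_left_distrib scale_left_diff_distrib scale_right_diff_distrib
  have lin: "Vector_Spaces.linear quat_scale scl \<phi>"
    unfolding Vector_Spaces.linear_iff
    by (auto simp: Q.vector_space_axioms vector_space_axioms \<phi>_def quat_scale_def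
        scale_right_distrib scale_left_distrib algebra_simps)
  have mul: "\<phi> (quat_mul a b x y) = \<phi> x * \<phi> y" for x y
    by (cases x; cases y) (simp add: \<phi>_def quat_mul_def simps algebra_simps)
  have \<sigma>\<phi>: "\<sigma> (\<phi> x) = \<phi> (quat_conj x)" for x
    by (cases x) (simp add: \<phi>_def quat_conj_def \<sigma>_simps IJ)
  have "inj \<phi>"
  proof (rule injI)
    fix x y assume "\<phi> x = \<phi> y"
    have "\<phi> z = 0 \<Longrightarrow> z = 0" for z
    proof -
      assume z: "\<phi> z = 0"
      obtain z0 z1 z2 z3 where zs: "z = (z0, z1, z2, z3)" by (cases z)
      define X0 X1 X2 X3 where X: "X0 = scl z0 1" "X1 = scl z1 I" "X2 = scl z2 J" "X3 = scl z3 (I * J)"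
      have 1: "X0 + X1 + X2 + X3 = 0" using z by (simp add: \<phi>_def zs X)
      \<comment> \<open>Up to a scalar, two-sided multiplication by \<open>I\<close> or
        \<open>J\<close> only changes signs of components; the four sign patterns together isolate
        each component.\<close>
      have conj: "I * (scl y0 1 + scl y1 I + scl y2 J + scl y3 (I * J)) * I =
            scl a (scl y0 1 + scl y1 I - scl y2 J - scl y3 (I * J))"
        "J * (scl y0 1 + scl y1 I + scl y2 J + scl y3 (I * J)) * J =
            scl b (scl y0 1 - scl y1 I + scl y2 J - scl y3 (I * J))" for y0 y1 y2 y3
        by (simp_all add: simps left_diff_distrib mult.commute)
      have 2: "X0 + X1 - X2 - X3 = 0"
        using conj(1)[of z0 z1 z2 z3] 1 ab by (simp flip: X)
      have 3: "X0 - X1 + X2 - X3 = 0"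
        using conj(2)[of z0 z1 z2 z3] 1 ab by (simp flip: X)
      have 4: "X0 - X1 - X2 + X3 = 0"
        using conj(2)[of z0 z1 "- z2" "- z3"] 2 ab by (simp flip: X)
      have "(X0 + X1) + (X0 + X1) = (X0 + X1 + X2 + X3) + (X0 + X1 - X2 - X3)"
        "(X0 - X1) + (X0 - X1) = (X0 - X1 + X2 - X3) + (X0 - X1 - X2 + X3)"
        by (simp_all add: algebra_simps)
      then have "X0 + X1 = 0" "X0 - X1 = 0" unfolding 1 2 3 4 by (simp_all only: double_eq_0 add_0)
      then have "X0 = 0" "X1 = 0" using double_eq_0[of X0] by auto
      moreover from this have "X2 + X3 = 0" "X2 - X3 = 0" using 1 3 by simp_all
      then have "X2 = 0" "X3 = 0" using double_eq_0[of X2] by auto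
      moreover have "I \<noteq> 0" "J \<noteq> 0" using IJ(3,4) ab by auto
      moreover have "I * J \<noteq> 0" using IJ'(1)[of J] \<open>J \<noteq> 0\<close> ab by auto
      ultimately show "z = 0" by (simp add: X zs zero_prod_def)
    qed
    moreover have "\<phi> (x - y) = 0"
      using module_hom.diff[OF Vector_Spaces.linear.axioms(3)[OF lin]] \<open>\<phi> x = \<phi> y\<close> by simp
    ultimately have "x - y = 0" by blast
    then show "x = y" by simp
  qed
  moreover have "\<phi> quat_one = 1" by (simp add: \<phi>_def quat_one_def)
  ultimately show ?thesis
    unfolding contains_with_involution_def algebra_hom_def
    using lin mul \<sigma>\<phi> by (intro exI[of _ \<phi>] exI[of _ quat_one]) (simp add: Q.mul_one_left Q.mul_one_right)
qed

end


section \<open>Eigenspaces of a Pfaffian adjoint of square one\<close>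

locale pfaffian_involution = involution_algebra +
  fixes p :: "'b \<Rightarrow> 'b"
  assumes p_linear: "Vector_Spaces.linear scl scl p"
    and p_skew: "\<sigma> r = - r \<Longrightarrow> \<sigma> (p r) = - p r"
    and p_scalar: "\<sigma> r = - r \<Longrightarrow> \<exists>n. r * p r = scl n 1"
    and p_p: "\<sigma> r = - r \<Longrightarrow> p (p r) = r"
    and sandwich: "\<sigma> r = - r \<Longrightarrow> (\<And>x. \<sigma> x = - x \<Longrightarrow> r * x * r = 0) \<Longrightarrow> r = 0"
    and skew_center: "\<sigma> r = - r \<Longrightarrow> (\<And>x. \<sigma> x = - x \<Longrightarrow> r * x = x * r) \<Longrightarrow> r = 0"
begin

lemma p_add: "p (x + y) = p x + p y" and p_scale: "p (scl c x) = scl c (p x)"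
  using p_linear by (auto simp: Vector_Spaces.linear_iff)

lemma p_diff: "p (x - y) = p x - p y"
  using p_add[of "x - y" y] by (simp add: algebra_simps)

definition Plus :: "'b set" where
  "Plus = {r. \<sigma> r = - r \<and> p r = r}"

definition Minus :: "'b set" where
  "Minus = {r. \<sigma> r = - r \<and> p r = - r}"

lemma Plus_add: "r \<in> Plus \<Longrightarrow> t \<in> Plus \<Longrightarrow> r + t \<in> Plus"
  and Plus_diff: "r \<in> Plus \<Longrightarrow> t \<in> Plus \<Longrightarrow> r - t \<in> Plus"
  and Plus_scale: "r \<in> Plus \<Longrightarrow> scl c r \<in> Plus"
  by (simp_all add: Plus_def \<sigma>_simps p_add p_diff p_scale)

lemma Plus_Minus_decomposition:
  assumes "\<sigma> r = - r"
  shows "\<exists>u\<in>Plus. \<exists>v\<in>Minus. r = u + v"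
proof -
  define u v where "u = scl (1 / 2) (r + p r)" and "v = scl (1 / 2) (r - p r)"
  have "u + v = scl (1 / 2) (r + r)" by (simp add: u_def v_def flip: scale_right_distrib)
  then have "r = u + v" by (simp add: scale_half_double)
  moreover have "u \<in> Plus" using assms
    by (simp add: u_def Plus_def \<sigma>_simps p_scale p_add p_p p_skew algebra_simps flip: scale_minus_right)
  moreover have "v \<in> Minus" using assms
    by (simp add: v_def Minus_def \<sigma>_simps p_scale p_diff p_p p_skew scale_right_diff_distrib)
  ultimately show ?thesis by blast
qed

lemma Plus_square: "r \<in> Plus \<Longrightarrow> \<exists>n. r * r = scl n 1"
  using p_scalar[of r] by (auto simp: Plus_def)

lemma Plus_anticommutator:
  assumes "r \<in> Plus" "t \<in> Plus"
  shows "\<exists>n. r * t + t * r = scl n 1"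
proof -
  obtain k l m where "r * r = scl k 1" "t * t = scl l 1" "(r + t) * (r + t) = scl m 1"
    using Plus_square assms Plus_add by metis
  then have "r * t + t * r = scl (m - k - l) 1"
    by (simp add: scale_left_diff_distrib algebra_simps)
  then show ?thesis ..
qed

text \<open>Polarizing \<open>r p(r)\<close> at \<open>r + t\<close> makes \<open>t r - r t\<close>
  a scalar; as a commutator of skew elements it is also skew, while \<open>\<sigma>\<close> fixes
  scalars.\<close>

lemma Plus_Minus_commute:
  assumes r: "r \<in> Plus" and t: "t \<in> Minus"
  shows "r * t = t * r"
proof -
  have rt: "\<sigma> r = - r" "p r = r" "\<sigma> t = - t" "p t = - t" using assms by (auto simp: Plus_def Minus_def)
  obtain k l m where klm: "r * p r = scl k 1" "t * p t = scl l 1" "(r + t) * p (r + t) = scl m 1"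
    using p_scalar[of r] p_scalar[of t] p_scalar[of "r + t"] rt by (auto simp: \<sigma>_simps)
  have "t * r - r * t = (r + t) * p (r + t) - r * p r - t * p t"
    by (simp add: rt p_add algebra_simps)
  also have "\<dots> = scl (m - k - l) 1" unfolding klm by (simp add: scale_left_diff_distrib)
  finally have "t * r - r * t = scl (m - k - l) 1" .
  then obtain n where n: "t * r - r * t = scl n 1" by blast
  have "\<sigma> (t * r - r * t) = - (t * r - r * t)" by (simp add: \<sigma>_simps rt)
  then have "scl n 1 = - scl n (1 :: 'b)" unfolding n by (simp add: \<sigma>_simps)
  then have "scl n (1 :: 'b) = 0" by (simp only: eq_minus_self)
  then show ?thesis using n by simp
qed

text \<open>Together with some \<open>t\<close> not orthogonal to it, \<open>r\<close> spans a
  hyperbolic plane in \<open>Plus\<close>, on which squaring represents 1. Without such a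
  \<open>t\<close>, \<open>r\<close> would anticommute with \<open>Plus\<close> and commute with
  \<open>Minus\<close>, so that \<open>r x r = 0\<close> for all skew \<open>x\<close>, against
  \<open>sandwich\<close>.\<close>

lemma isotropic_imp_hyperbolic:
  assumes r: "r \<in> Plus" "r \<noteq> 0" "r * r = 0"
  shows "hyperbolic (*) 1 \<sigma>"
proof -
  have "\<exists>t\<in>Plus. r * t + t * r \<noteq> 0"
  proof (rule ccontr)
    assume "\<not> (\<exists>t\<in>Plus. r * t + t * r \<noteq> 0)"
    then have anti: "r * t = - (t * r)" if "t \<in> Plus" for t using that by (simp add: eq_neg_iff_add_eq_0)
    have "r * x * r = 0" if x: "\<sigma> x = - x" for x
    proof -
      obtain u v where uv: "u \<in> Plus" "v \<in> Minus" "x = u + v"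
        using Plus_Minus_decomposition[OF x] by blast
      have "r * x * r = - (u * (r * r)) + v * (r * r)"
        using anti[OF uv(1)] Plus_Minus_commute[OF r(1) uv(2)]
        by (simp add: uv(3) distrib_left distrib_right left_diff_distrib mult.assoc)
      then show ?thesis by (simp add: r)
    qed
    then show False using sandwich[of r] r by (auto simp: Plus_def)
  qed
  then obtain t where t: "t \<in> Plus" "r * t + t * r \<noteq> 0" by blast
  obtain m n where mn: "t * t = scl m 1" "r * t + t * r = scl n 1"
    using Plus_square Plus_anticommutator t r by metis
  then have "n \<noteq> 0" using t by auto
  \<comment> \<open>Since \<open>(t + l r)^2 = m + l n\<close>, this coefficient produces the square
    1.\<close>
  define u where "u = t + scl ((1 - m) / n) r"
  have "u * u = t * t + scl ((1 - m) / n) (r * t + t * r)"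
    by (simp add: u_def distrib_left distrib_right mul_scale_left mul_scale_right r scale_right_distrib algebra_simps)
  also have "\<dots> = scl (m + (1 - m) / n * n) 1"
    unfolding mn by (simp add: scale_left_distrib)
  also have "\<dots> = 1" using \<open>n \<noteq> 0\<close> by simp
  finally have "u * u = 1" .
  moreover have "u \<in> Plus" unfolding u_def by (intro Plus_add Plus_scale t r)
  ultimately show ?thesis unfolding hyperbolic_iff Plus_def by blast
qed

text \<open>An anisotropic \<open>Plus\<close> is the space of pure quaternions of \<open>(c,d)\<close>.\<close>

lemma Plus_basis:
  assumes an: "\<And>r. r \<in> Plus \<Longrightarrow> r * r = 0 \<Longrightarrow> r = 0" and "Plus \<noteq> {0}"
  obtains e1 e2 c d where "c \<noteq> 0" "d \<noteq> 0" "e1 \<in> Plus" "e2 \<in> Plus" "e1 * e2 \<in> Plus"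
    "e1 * e1 = scl c 1" "e2 * e2 = scl d 1" "e2 * e1 = - (e1 * e2)"
    "\<And>x. x \<in> Plus \<Longrightarrow> \<exists>k l m. x = scl k e1 + scl l e2 + scl m (e1 * e2)"
proof -
  have "0 \<in> Plus" using Plus_def p_diff[of 0 0] \<sigma>_diff[of 0 0] by simp
  then obtain e1 where e1: "e1 \<in> Plus" "e1 \<noteq> 0" using assms(2) by blast
  obtain c where c: "e1 * e1 = scl c 1" using Plus_square e1 by blast
  have c0: "c \<noteq> 0" using an[OF e1(1)] e1(2) c by auto
  \<comment> \<open>Otherwise \<open>e1\<close> would commute with \<open>Plus\<close> and
    \<open>Minus\<close>, hence with all skew elements.\<close>
  have "\<exists>t\<in>Plus. e1 * t \<noteq> t * e1"
  proof (rule ccontr)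
    assume "\<not> (\<exists>t\<in>Plus. e1 * t \<noteq> t * e1)"
    then have "e1 * x = x * e1" if "\<sigma> x = - x" for x
      using Plus_Minus_decomposition[OF that] Plus_Minus_commute[OF e1(1)]
      by (auto simp: distrib_left distrib_right)
    then show False using skew_center[of e1] e1 by (auto simp: Plus_def)
  qed
  then obtain t where t: "t \<in> Plus" "e1 * t \<noteq> t * e1" by blast
  obtain n where n: "e1 * t + t * e1 = scl n 1" using Plus_anticommutator e1 t by blast
  \<comment> \<open>Gram-Schmidt: removing the component along \<open>e1\<close> makes
    \<open>e1\<close> and \<open>e2\<close> anticommute.\<close>
  define e2 where "e2 = t - scl (n / (2 * c)) e1"
  have e2: "e2 \<in> Plus" unfolding e2_def by (intro Plus_diff Plus_scale t e1)
  have "e2 \<noteq> 0"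
  proof
    assume "e2 = 0"
    then have "t = scl (n / (2 * c)) e1" by (simp add: e2_def)
    then show False using t(2) by (simp add: mul_scale_left mul_scale_right)
  qed
  obtain d where d: "e2 * e2 = scl d 1" using Plus_square e2 by blast
  have d0: "d \<noteq> 0" using an[OF e2] \<open>e2 \<noteq> 0\<close> d by auto
  have half: "scl (k / (2 * l)) (scl l 1 + scl l 1) = scl k (1 :: 'b)" if "l \<noteq> 0" for k l
    using that two by (simp add: field_simps flip: scale_left_distrib)
  have "e1 * e2 + e2 * e1 = (e1 * t + t * e1) - scl (n / (2 * c)) (e1 * e1 + e1 * e1)"
    by (simp add: e2_def algebra_simps mul_scale_left mul_scale_right scale_right_distrib)
  also have "\<dots> = 0" unfolding n c half[OF c0] by simp
  finally have e21: "e2 * e1 = - (e1 * e2)" by (simp add: eq_neg_iff_add_eq_0 add.commute)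
  have rules: "e1 * (e1 * z) = scl c z" "e2 * (e2 * z) = scl d z" "e2 * (e1 * z) = - (e1 * (e2 * z))" for z
    by (simp_all add: c d e21 mul_scale_left flip: mult.assoc)
  note simps = rules c d e21 mult.assoc mul_scale_left mul_scale_right
  define e3 where "e3 = e1 * e2"
  have sk: "\<sigma> e1 = - e1" "\<sigma> e2 = - e2" using e1 e2 by (auto simp: Plus_def)
  have e3_skew: "\<sigma> e3 = - e3" by (simp add: e3_def \<sigma>_simps sk e21)
  have e33: "e3 * e3 = scl (- (c * d)) 1" by (simp add: e3_def simps mult.commute)
  have "e3 \<noteq> 0" using e33 c0 d0 by auto
  \<comment> \<open>\<open>e3\<close> is invertible and \<open>e3 p(e3)\<close> a scalar, so
    \<open>e3\<close> is an eigenvector of \<open>p\<close>.\<close>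
  obtain m where m: "e3 * p e3 = scl m 1" using p_scalar[OF e3_skew] by blast
  have "e3 * (e3 * p e3) = scl (- (c * d)) (p e3)"
    using e33 by (simp add: mul_scale_left flip: mult.assoc)
  then have "scl (- (c * d)) (p e3) = scl m e3" by (simp add: m mul_scale_right)
  then have "scl (- inverse (c * d)) (scl (- (c * d)) (p e3)) = scl (- inverse (c * d)) (scl m e3)" by simp
  then have "p e3 = scl (- (m / (c * d))) e3" using c0 d0 by (simp add: field_simps)
  then obtain \<kappa> where \<kappa>: "p e3 = scl \<kappa> e3" by blast
  have "scl (\<kappa> * \<kappa>) e3 = scl 1 e3" using p_p[OF e3_skew] by (simp add: \<kappa> p_scale)
  then have "\<kappa> * \<kappa> = 1" using \<open>e3 \<noteq> 0\<close> by (simp only: scale_right_imp_eq scale_cancel_right) simp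
  then have "\<kappa> = 1 \<or> \<kappa> = - 1" by (simp add: square_eq_1_iff)
  \<comment> \<open>In \<open>Minus\<close>, \<open>e3\<close> would commute with \<open>e1\<close>,
    but \<open>e1\<close> and \<open>e1 e2\<close> anticommute.\<close>
  moreover have "\<kappa> \<noteq> - 1"
  proof
    assume "\<kappa> = - 1"
    then have "e3 \<in> Minus" using e3_skew \<kappa> by (simp add: Minus_def)
    from Plus_Minus_commute[OF e1(1) this] have "scl c e2 = - scl c e2"
      by (simp add: e3_def simps)
    then have "scl c e2 = 0" by (simp only: eq_minus_self)
    then show False using c0 \<open>e2 \<noteq> 0\<close> by simp
  qed
  ultimately have e3: "e3 \<in> Plus" using e3_skew \<kappa> by (auto simp: Plus_def)
  have "\<exists>k l m. x = scl k e1 + scl l e2 + scl m (e1 * e2)" if x: "x \<in> Plus" for x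
  proof -
    obtain n1 n2 n3 where ns: "e1 * x + x * e1 = scl n1 1" "e2 * x + x * e2 = scl n2 1" "e3 * x + x * e3 = scl n3 1"
      using Plus_anticommutator e1 e2 e3 x by metis
    \<comment> \<open>Subtracting the projection of \<open>x\<close> to the span of
      \<open>e1\<close>, \<open>e2\<close>, \<open>e3\<close> leaves an element that anticommutes
      with all three.\<close>
    define y where "y = x - (scl (n1 / (2 * c)) e1 + scl (n2 / (2 * d)) e2 + scl (n3 / (2 * - (c * d))) e3)"
    have "e1 * y + y * e1 = (e1 * x + x * e1) - scl (n1 / (2 * c)) (e1 * e1 + e1 * e1)
        - scl (n2 / (2 * d)) (e1 * e2 + e2 * e1) - scl (n3 / (2 * - (c * d))) (e1 * e3 + e3 * e1)"
      unfolding y_def distrib_left distrib_right left_diff_distrib right_diff_distrib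
        mul_scale_left mul_scale_right scale_right_distrib by (simp add: algebra_simps)
    then have y1: "e1 * y + y * e1 = 0" using half[OF c0] by (simp add: ns e3_def simps)
    have "e2 * y + y * e2 = (e2 * x + x * e2) - scl (n1 / (2 * c)) (e1 * e2 + e2 * e1)
        - scl (n2 / (2 * d)) (e2 * e2 + e2 * e2) - scl (n3 / (2 * - (c * d))) (e2 * e3 + e3 * e2)"
      unfolding y_def distrib_left distrib_right left_diff_distrib right_diff_distrib
        mul_scale_left mul_scale_right scale_right_distrib by (simp add: algebra_simps)
    then have y2: "e2 * y + y * e2 = 0" using half[OF d0] by (simp add: ns e3_def simps)
    have eq: "e3 * y + y * e3 = (e3 * x + x * e3) - scl (n1 / (2 * c)) (e1 * e3 + e3 * e1)
        - scl (n2 / (2 * d)) (e2 * e3 + e3 * e2) - scl (n3 / (2 * - (c * d))) (e3 * e3 + e3 * e3)"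
      unfolding y_def distrib_left distrib_right left_diff_distrib right_diff_distrib
        mul_scale_left mul_scale_right scale_right_distrib by (simp add: algebra_simps)
    have anti: "e1 * e3 + e3 * e1 = 0" "e2 * e3 + e3 * e2 = 0" by (simp_all add: e3_def simps)
    have n3: "scl (n3 / (2 * - (c * d))) (e3 * e3 + e3 * e3) = scl n3 1"
      unfolding e33 using half[of "- (c * d)" n3] c0 d0 by simp
    have y3: "e3 * y + y * e3 = 0" unfolding eq anti n3 ns by simp
    \<comment> \<open>Anticommuting with \<open>e1\<close> and \<open>e2\<close>, \<open>y\<close>
      commutes with \<open>e3 = e1 e2\<close>; with \<open>y3\<close> this gives
      \<open>e3 y = 0\<close>.\<close>
    have "y * e3 = y * e1 * e2" by (simp add: e3_def mult.assoc)
    also have "y * e1 = - (e1 * y)" using y1 by (simp add: eq_neg_iff_add_eq_0 add.commute)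
    also have "- (e1 * y) * e2 = - (e1 * (y * e2))" by (simp add: mult.assoc)
    also have "y * e2 = - (e2 * y)" using y2 by (simp add: eq_neg_iff_add_eq_0 add.commute)
    also have "- (e1 * - (e2 * y)) = e3 * y" by (simp add: e3_def mult.assoc)
    finally have "e3 * y = 0" using y3 double_eq_0[of "e3 * y"] by simp
    then have "e3 * (e3 * y) = 0" by simp
    then have "scl (- (c * d)) y = 0" using e33 by (simp add: mul_scale_left flip: mult.assoc)
    then have "y = 0" using c0 d0 by simp
    then show ?thesis unfolding y_def e3_def right_minus_eq by blast
  qed
  then show ?thesis using that[OF c0 d0 e1(1) e2 e3[unfolded e3_def] c d e21] by blast
qed

end


section \<open>Scalar extension of involutions\<close>

locale base_change_involution = base_change scl "(*)" 1 \<epsilon> scaleK "(*)" 1 \<iota>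
  for scl :: "'f::field \<Rightarrow> 'a::ring_1 \<Rightarrow> 'a" and \<epsilon> :: "'f \<Rightarrow> 'k::field"
    and scaleK :: "'k \<Rightarrow> 'b::ring_1 \<Rightarrow> 'b" and \<iota> :: "'a \<Rightarrow> 'b" +
  fixes \<sigma> :: "'a \<Rightarrow> 'a" and \<sigma>K :: "'b \<Rightarrow> 'b"
  assumes two: "(2 :: 'f) \<noteq> 0" and inv: "involution scl (*) \<sigma>"
    and extended: "extended_map scaleK \<iota> \<sigma> \<sigma>K"
begin

sublocale F: involution_algebra scl \<sigma>
  using two inv by unfold_locales

lemma \<sigma>K_linear: "\<sigma>K (u + v) = \<sigma>K u + \<sigma>K v" "\<sigma>K (scaleK k u) = scaleK k (\<sigma>K u)"
  and \<sigma>K_\<iota>: "\<sigma>K (\<iota> x) = \<iota> (\<sigma> x)"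
  using extended by (auto simp: extended_map_def Vector_Spaces.linear_iff)

lemma involution_extended: "involution scaleK (*) \<sigma>K"
proof -
  have "\<sigma>K (u * v) = \<sigma>K v * \<sigma>K u" for u v
  proof (induction u rule: base_change_induct)
    case (scale k x)
    show ?case
    proof (induction v rule: base_change_induct)
      case (scale l y)
      show ?case
        by (simp add: \<sigma>K_linear \<sigma>K_\<iota> B.mul_scale_left B.mul_scale_right F.\<sigma>_mult mult.commute flip: \<iota>_mul)
    qed (simp add: \<sigma>K_linear distrib_left distrib_right)
  qed (simp add: \<sigma>K_linear distrib_left distrib_right)
  moreover have "\<sigma>K (\<sigma>K u) = u" for u
    by (induction u rule: base_change_induct) (simp_all add: \<sigma>K_linear \<sigma>K_\<iota> F.\<sigma>_\<sigma>)
  ultimately show ?thesis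
    using extended by (simp add: involution_def extended_map_def)
qed

sublocale K: involution_algebra scaleK \<sigma>K
  using involution_extended two hom_simps(7,8) by unfold_locales metis

text \<open>Here \<open>t = u - \<sigma>K u\<close> with \<open>u = t / 2\<close>, and a pure tensor
  \<open>k \<iota>(x)\<close> in \<open>u\<close> contributes
  \<open>k \<iota>(x - \<sigma> x)\<close>.\<close>

lemma skew_extended_induct [consumes 1, case_names scale add]:
  assumes t: "\<sigma>K t = - t"
    and scale: "\<And>k x. \<sigma> x = - x \<Longrightarrow> P (scaleK k (\<iota> x))"
    and add: "\<And>u v. \<sigma>K u = - u \<Longrightarrow> \<sigma>K v = - v \<Longrightarrow> P u \<Longrightarrow> P v \<Longrightarrow> P (u + v)"
  shows "P t"
proof -
  have "P (u - \<sigma>K u)" for u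
  proof (induction u rule: base_change_induct)
    case (scale k x)
    have "scaleK k (\<iota> x) - \<sigma>K (scaleK k (\<iota> x)) = scaleK k (\<iota> (x - \<sigma> x))"
      by (simp add: \<sigma>K_linear \<sigma>K_\<iota> \<iota>_diff B.scale_right_diff_distrib)
    then show ?case using assms(2)[of "x - \<sigma> x" k] by (simp add: F.\<sigma>_simps)
  next
    case (add u v)
    have eq: "u + v - \<sigma>K (u + v) = (u - \<sigma>K u) + (v - \<sigma>K v)" by (simp add: \<sigma>K_linear)
    show ?case unfolding eq by (rule assms(3)) (use add in \<open>simp_all add: K.\<sigma>_simps\<close>)
  qed
  from this[of "scaleK (1 / 2) t"] show ?thesis
    using K.scale_half_double[of t] by (simp add: \<sigma>K_linear t B.scale_right_distrib)
qed

lemma hyperbolic_extended: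
  assumes "hyperbolic (*) 1 \<sigma>"
  shows "hyperbolic (*) 1 \<sigma>K"
proof -
  obtain e where "e * e = e" "\<sigma> e = 1 - e" using assms by (auto simp: hyperbolic_def)
  then have "\<iota> e * \<iota> e = \<iota> e" "\<sigma>K (\<iota> e) = 1 - \<iota> e"
    by (simp_all add: \<sigma>K_\<iota> \<iota>_diff \<iota>_one flip: \<iota>_mul)
  then show ?thesis by (auto simp: hyperbolic_def)
qed

text \<open>As \<open>I\<close> and \<open>J\<close> anticommute, the skew element
  \<open>x I + y J\<close> has square \<open>a x^2 + b y^2 = 1\<close>.\<close>

lemma hyperbolic_of_quaternions:
  assumes IJ: "\<sigma> I = - I" "\<sigma> J = - J" "I * I = scl a 1" "J * J = scl b 1" "I * J = - (J * I)"
    and xy: "\<epsilon> a * (x * x) + \<epsilon> b * (y * y) = 1"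
  shows "hyperbolic (*) 1 \<sigma>K"
proof -
  define s where "s = scaleK x (\<iota> I) + scaleK y (\<iota> J)"
  have "\<sigma>K s = - s" by (simp add: s_def K.\<sigma>_simps \<sigma>K_\<iota> IJ \<iota>_minus)
  have "s * s = scaleK (x * x) (\<iota> (I * I)) + scaleK (y * y) (\<iota> (J * J)) + scaleK (x * y) (\<iota> (I * J) + \<iota> (J * I))"
    by (simp add: s_def distrib_left distrib_right B.mul_scale_left B.mul_scale_right \<iota>_mul
        B.scale_right_distrib mult.commute[of y x] add_ac)
  also have "\<dots> = scaleK (\<epsilon> a * (x * x) + \<epsilon> b * (y * y)) 1"
    by (simp add: IJ \<iota>_scale \<iota>_one \<iota>_minus B.scale_left_distrib mult.commute)
  finally have "s * s = 1" by (simp add: xy)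
  with \<open>\<sigma>K s = - s\<close> show ?thesis unfolding K.hyperbolic_iff by blast
qed

text \<open>
  With \<open>\<kappa>\<close> defined by \<open>p s = \<kappa> s\<close>, polarizing \<open>r p(r) \<in> K\<close> gives \<open>p(t) = n(t) s - \<kappa> s t s\<close> for all
  skew-symmetric \<open>t\<close>, so that \<open>p\<^sup>2 = \<kappa>\<^sup>2\<close>.
\<close>

lemma pfaffian_normalization:
  assumes p: "Vector_Spaces.linear scl scl p"
    and p_skew: "\<And>r. \<sigma> r = - r \<Longrightarrow> \<sigma> (p r) = - p r"
    and p_scalar: "\<And>r. \<sigma> r = - r \<Longrightarrow> \<exists>n. r * p r = scl n 1"
    and r0: "\<sigma> r0 = - r0" "p r0 \<noteq> 0"
    and s: "\<sigma>K s = - s" "s * s = 1"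
    and descent: "\<And>\<kappa> \<mu>. \<kappa> * \<kappa> = \<epsilon> \<mu> \<Longrightarrow> \<exists>\<nu>. \<nu> * \<nu> = \<mu>"
  shows "\<exists>q qK. Vector_Spaces.linear scl scl q \<and> extended_map scaleK \<iota> q qK \<and> qK s = s \<and>
    (\<forall>r. \<sigma> r = - r \<longrightarrow> \<sigma> (q r) = - q r \<and> (\<exists>n. r * q r = scl n 1) \<and> q (q r) = r)"
proof -
  have p_lin: "p (x + y) = p x + p y" "p (scl c x) = scl c (p x)" for x y c
    using p by (auto simp: Vector_Spaces.linear_iff)
  obtain pK where pK: "extended_map scaleK \<iota> p pK" using extend_linear_map[OF p] by blast
  have pK_add: "pK (u + v) = pK u + pK v" and pK_scale: "pK (scaleK k u) = scaleK k (pK u)"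
    and pK_\<iota>: "pK (\<iota> x) = \<iota> (p x)" for u v k x
    using pK by (auto simp: extended_map_def Vector_Spaces.linear_iff)
  have pK_minus: "pK (- u) = - pK u" for u
    using pK_scale[of "- 1" u] by simp
  have pK_diff: "pK (u - v) = pK u - pK v" for u v
    using pK_add[of u "- v"] by (simp add: pK_minus)
  have p_pair: "\<exists>n. x * p y + y * p x = scl n 1" if xy: "\<sigma> x = - x" "\<sigma> y = - y" for x y
  proof -
    obtain k l m where klm: "x * p x = scl k 1" "y * p y = scl l 1" "(x + y) * p (x + y) = scl m 1"
      using p_scalar[OF xy(1)] p_scalar[OF xy(2)] p_scalar[of "x + y"] xy
      by (metis F.\<sigma>_add minus_add_distrib)
    have "x * p y + y * p x = (x + y) * p (x + y) - x * p x - y * p y"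
      by (simp add: p_lin algebra_simps)
    also have "\<dots> = scl (m - k - l) 1" unfolding klm by (simp add: A.scale_left_diff_distrib)
    finally show ?thesis by blast
  qed
  \<comment> \<open>The polarized pairing is additive in each argument, hence passes to
    \<open>A \<otimes> K\<close>; the quadratic statement is recovered from it by halving in
    \<open>self_pair\<close>.\<close>
  have pair: "\<exists>n. u * pK v + v * pK u = scaleK n 1" if "\<sigma>K u = - u" "\<sigma>K v = - v" for u v
    using that
  proof (induction u rule: skew_extended_induct)
    case (scale k x)
    from scale(2) show ?case
    proof (induction v rule: skew_extended_induct)
      case (scale l y)
      obtain n where n: "x * p y + y * p x = scl n 1" using p_pair \<open>\<sigma> x = - x\<close> scale by blast
      have "scaleK k (\<iota> x) * pK (scaleK l (\<iota> y)) + scaleK l (\<iota> y) * pK (scaleK k (\<iota> x)) =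
          scaleK (k * l) (\<iota> (x * p y + y * p x))"
        by (simp add: pK_scale pK_\<iota> B.mul_scale_left B.mul_scale_right B.scale_right_distrib
            \<iota>_add \<iota>_mul mult.commute)
      then show ?case by (auto simp: n \<iota>_scale \<iota>_one)
    next
      case (add v w)
      then obtain m n where "scaleK k (\<iota> x) * pK v + v * pK (scaleK k (\<iota> x)) = scaleK m 1"
        "scaleK k (\<iota> x) * pK w + w * pK (scaleK k (\<iota> x)) = scaleK n 1" by blast
      then have "scaleK k (\<iota> x) * pK (v + w) + (v + w) * pK (scaleK k (\<iota> x)) = scaleK (m + n) 1"
        unfolding pK_add distrib_left distrib_right B.scale_left_distrib by (metis add.assoc add.commute)
      then show ?case ..
    qed
  next
    case (add u w)
    then obtain m n where "u * pK v + v * pK u = scaleK m 1" "w * pK v + v * pK w = scaleK n 1" by blast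
    then have "(u + w) * pK v + v * pK (u + w) = scaleK (m + n) 1"
      unfolding pK_add distrib_left distrib_right B.scale_left_distrib by (metis add.assoc add.commute)
    then show ?case ..
  qed
  have self_pair: "\<exists>n. u * pK u = scaleK n 1" if u: "\<sigma>K u = - u" for u
  proof -
    obtain n where "u * pK u + u * pK u = scaleK n 1" using pair[OF u u] by blast
    then have "u * pK u = scaleK (1 / 2 * n) 1" by (metis K.scale_half_double B.scale_scale)
    then show ?thesis ..
  qed
  have s_cancel: "s * (s * u) = u" for u
    using s(2) by (simp flip: mult.assoc)
  obtain \<kappa> where "s * pK s = scaleK \<kappa> 1" using self_pair[OF s(1)] by blast
  then have "s * (s * pK s) = s * scaleK \<kappa> 1" by simp
  then have \<kappa>: "pK s = scaleK \<kappa> s" by (simp add: s_cancel B.mul_scale_right)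
  have formula: "\<exists>n. pK t = scaleK n s - scaleK \<kappa> (s * t * s)" if t: "\<sigma>K t = - t" for t
  proof -
    obtain n where n: "s * pK t + t * pK s = scaleK n 1" using pair[OF s(1) t] by blast
    then have "s * pK t = scaleK n 1 - t * pK s" by (simp add: algebra_simps)
    then have "s * (s * pK t) = s * (scaleK n 1 - t * pK s)" by simp
    then have "pK t = scaleK n s - scaleK \<kappa> (s * t * s)"
      by (simp add: s_cancel \<kappa> right_diff_distrib B.mul_scale_right mult.assoc)
    then show ?thesis ..
  qed
  have pK_pK: "pK (pK t) = scaleK (\<kappa> * \<kappa>) t" if t: "\<sigma>K t = - t" for t
  proof -
    \<comment> \<open>Since \<open>s^2 = 1\<close>, conjugation by \<open>s\<close> has order at
      most 2; \<open>t0\<close> and \<open>t1\<close> are the components of \<open>2 t\<close> in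
      its eigenspaces.\<close>
    define t0 t1 where "t0 = t + s * t * s" and "t1 = t - s * t * s"
    have skew: "\<sigma>K t0 = - t0" "\<sigma>K t1 = - t1"
      by (simp_all add: t0_def t1_def K.\<sigma>_simps t s mult.assoc)
    have st: "s * t0 * s = t0" "s * t1 * s = - t1"
      by (simp_all add: t0_def t1_def algebra_simps s s_cancel mult.assoc)
    obtain n0 where n0: "pK t0 = scaleK n0 s - scaleK \<kappa> t0" using formula[OF skew(1)] st by auto
    have pp0: "pK (pK t0) = scaleK (\<kappa> * \<kappa>) t0"
      by (simp add: n0 pK_diff pK_scale \<kappa> B.scale_right_diff_distrib mult.commute)
    obtain n1 where n1: "pK t1 = scaleK n1 s + scaleK \<kappa> t1" using formula[OF skew(2)] st by auto
    \<comment> \<open>The scalar \<open>t1 pK(t1)\<close> commutes with \<open>s\<close>, while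
      \<open>t1\<close> anticommutes with \<open>s\<close>; comparing both products with
      \<open>s\<close> isolates \<open>n1 t1\<close>.\<close>
    have "scaleK n1 t1 = 0"
    proof -
      obtain m where m: "t1 * pK t1 = scaleK m 1" using self_pair[OF skew(2)] by blast
      have anti: "s * t1 = - (t1 * s)"
      proof -
        have "s * t1 = s * t1 * s * s" by (simp add: mult.assoc s)
        then show ?thesis by (simp add: st)
      qed
      then have anti': "s * (t1 * u) = - (t1 * (s * u))" for u
        by (simp flip: mult.assoc)
      have "s * (t1 * pK t1) = (t1 * pK t1) * s" by (simp add: m B.mul_scale_left B.mul_scale_right)
      then have "scaleK n1 t1 = - scaleK n1 t1"
        by (simp add: n1 distrib_left distrib_right B.mul_scale_left B.mul_scale_right mult.assoc anti anti' s)
      then show ?thesis by (simp only: K.eq_minus_self)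
    qed
    then have "n1 = 0 \<or> t1 = 0" by simp
    then have "pK t1 = scaleK \<kappa> t1" using n1 pK_scale[of 0 0] by auto
    then have pp1: "pK (pK t1) = scaleK (\<kappa> * \<kappa>) t1" by (simp add: pK_scale)
    have "t0 + t1 = t + t" by (simp add: t0_def t1_def)
    then have tt: "t = scaleK (1 / 2) (t0 + t1)" using K.scale_half_double[of t] by simp
    show ?thesis
      by (subst (1 2) tt) (simp add: pK_scale pK_add pp0 pp1 B.scale_right_distrib mult.commute)
  qed
  have \<iota>_pp: "\<iota> (p (p r)) = scaleK (\<kappa> * \<kappa>) (\<iota> r)" if "\<sigma> r = - r" for r
    using pK_pK[of "\<iota> r"] that by (simp add: pK_\<iota> \<sigma>K_\<iota> \<iota>_minus)
  have r0': "r0 \<noteq> 0" using r0(2) p_lin(2)[of 0 0] by auto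
  \<comment> \<open>If \<open>\<kappa> = 0\<close>, then \<open>pK (\<iota> r0)\<close> is a nonzero
    multiple of \<open>s\<close>; as \<open>\<iota> r0 * pK (\<iota> r0)\<close> is a scalar,
    \<open>\<iota> r0\<close> is a multiple of \<open>s\<close> too, and \<open>pK s = 0\<close>
    gives a contradiction.\<close>
  have \<kappa>0: "\<kappa> \<noteq> 0"
  proof
    assume "\<kappa> = 0"
    have skew: "\<sigma>K (\<iota> r0) = - \<iota> r0" by (simp add: \<sigma>K_\<iota> r0 \<iota>_minus)
    obtain n where n: "pK (\<iota> r0) = scaleK n s" using formula[OF skew] \<open>\<kappa> = 0\<close> by auto
    have nz: "pK (\<iota> r0) \<noteq> 0" by (simp add: pK_\<iota> \<iota>_eq_0 r0)
    then have "n \<noteq> 0" using n by auto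
    obtain m where "\<iota> r0 * pK (\<iota> r0) = scaleK m 1" using self_pair[OF skew] by blast
    then have "scaleK n (\<iota> r0 * s) = scaleK m 1" by (simp add: n B.mul_scale_right)
    then have "scaleK n (\<iota> r0 * s) * s = scaleK m 1 * s" by simp
    then have "scaleK n (\<iota> r0) = scaleK m s" by (simp add: B.mul_scale_left mult.assoc s)
    then have "pK (scaleK n (\<iota> r0)) = 0" by (simp add: pK_scale \<kappa> \<open>\<kappa> = 0\<close>)
    then show False using nz \<open>n \<noteq> 0\<close> by (simp add: pK_scale)
  qed
  \<comment> \<open>A functional with value 1 at \<open>r0\<close> reads \<open>\<kappa>^2\<close>
    off from \<open>p (p r0)\<close>, so \<open>\<kappa>^2\<close> lies in \<open>F\<close>.\<close>
  obtain g where g: "Vector_Spaces.linear scl (*) g" "g r0 = 1" using A.functional_nonzero[OF r0'] by blast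
  then obtain G where G: "Vector_Spaces.linear scaleK (*) G" "\<And>x. G (\<iota> x) = \<epsilon> (g x)"
    using extend_functional by blast
  have "\<kappa> * \<kappa> = \<epsilon> (g (p (p r0)))"
  proof -
    have "G (\<iota> (p (p r0))) = \<kappa> * \<kappa> * G (\<iota> r0)"
      unfolding \<iota>_pp[OF r0(1)] using G(1) by (simp add: Vector_Spaces.linear_iff)
    then show ?thesis by (simp add: G(2) g(2) hom_simps)
  qed
  then obtain \<nu> where "\<kappa> * \<kappa> = \<epsilon> (\<nu> * \<nu>)" using descent by metis
  then have "\<kappa> = \<epsilon> \<nu> \<or> \<kappa> = \<epsilon> (- \<nu>)"
    by (simp add: hom_simps square_eq_iff)
  then obtain \<nu> where \<nu>: "\<epsilon> \<nu> = \<kappa>" by metis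
  then have \<nu>0: "\<nu> \<noteq> 0" using \<kappa>0 hom_simps(4) by auto
  have "\<epsilon> (inverse \<nu>) * \<kappa> = \<epsilon> (inverse \<nu> * \<nu>)" by (simp only: hom_simps \<nu>)
  then have "\<epsilon> (inverse \<nu>) * \<kappa> = 1" using \<nu>0 by (simp add: hom_simps(3))
  then have \<nu>_inv: "\<epsilon> (inverse \<nu>) = inverse \<kappa>" using \<kappa>0 by (simp add: field_simps)
  define q where "q r = scl (inverse \<nu>) (p r)" for r
  define qK where "qK u = scaleK (inverse \<kappa>) (pK u)" for u
  have "Vector_Spaces.linear scl scl q"
    unfolding Vector_Spaces.linear_iff
    by (simp add: q_def p_lin A.scale_right_distrib mult.commute A.vector_space_axioms)
  moreover have "extended_map scaleK \<iota> q qK"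
    unfolding extended_map_def Vector_Spaces.linear_iff
    by (simp add: q_def qK_def pK_add pK_scale pK_\<iota> \<iota>_scale \<nu>_inv B.scale_right_distrib mult.commute B.vector_space_axioms)
  moreover have "qK s = s" using \<kappa>0 by (simp add: qK_def \<kappa>)
  moreover have "\<sigma> (q r) = - q r \<and> (\<exists>n. r * q r = scl n 1) \<and> q (q r) = r" if "\<sigma> r = - r" for r
  proof (intro conjI)
    show "\<sigma> (q r) = - q r" by (simp add: q_def F.\<sigma>_simps p_skew that)
    show "\<exists>n. r * q r = scl n 1" using p_scalar[OF that] by (auto simp: q_def A.mul_scale_right)
    have "inverse \<kappa> * inverse \<kappa> * (\<kappa> * \<kappa>) = 1" using \<kappa>0 by (simp add: field_simps)
    then have "\<iota> (q (q r)) = \<iota> r"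
      by (simp add: q_def p_lin \<iota>_scale \<iota>_pp[OF that] \<nu>_inv hom_simps)
    then show "q (q r) = r" by (simp add: \<iota>_eq)
  qed
  ultimately show ?thesis by blast
qed

end


section \<open>Descent of hyperbolicity\<close>

text \<open>Degree 4 and orthogonality enter through \<open>sandwich\<close>,
  \<open>skew_center\<close> and \<open>pfaffian\<close>, the arithmetic of the function field
  through \<open>conic\<close>.\<close>

lemma (in base_change_involution) hyperbolic_descent:
  assumes conic: "conic_point a b \<epsilon> x y"
    and sandwich: "\<And>r. \<sigma> r = - r \<Longrightarrow> (\<And>x. \<sigma> x = - x \<Longrightarrow> r * x * r = 0) \<Longrightarrow> r = 0"
    and skew_center: "\<And>r. \<sigma> r = - r \<Longrightarrow> (\<And>x. \<sigma> x = - x \<Longrightarrow> r * x = x * r) \<Longrightarrow> r = 0"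
    and pfaffian: "\<And>s. \<sigma> s = - s \<Longrightarrow> s \<noteq> 0 \<Longrightarrow> \<exists>p. Vector_Spaces.linear scl scl p \<and>
      (\<forall>r. \<sigma> r = - r \<longrightarrow> \<sigma> (p r) = - p r \<and> (\<exists>n. r * p r = scl n 1)) \<and> p s \<noteq> 0"
    and hyp: "hyperbolic (*) 1 \<sigma>K"
  shows "hyperbolic (*) 1 \<sigma> \<or>
    contains_with_involution scl (*) 1 \<sigma> quat_scale (quat_mul a b) quat_one quat_conj"
proof -
  interpret conic: conic_point a b \<epsilon> x y by (rule conic)
  obtain s where s: "\<sigma>K s = - s" "s * s = 1" using hyp K.hyperbolic_iff by blast
  have s0: "s \<noteq> 0" using s(2) by auto
  \<comment> \<open>The skew elements of \<open>A\<close> span those of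
    \<open>A \<otimes> K\<close>, among which is \<open>s \<noteq> 0\<close>.\<close>
  have "\<exists>r. \<sigma> r = - r \<and> r \<noteq> 0"
  proof (rule ccontr)
    assume "\<not> (\<exists>r. \<sigma> r = - r \<and> r \<noteq> 0)"
    with s(1) have "s = 0" by (induction s rule: skew_extended_induct) (auto simp: \<iota>_0)
    then show False using s0 by simp
  qed
  then obtain r0 where r0: "\<sigma> r0 = - r0" "r0 \<noteq> 0" by blast
  obtain p where p: "Vector_Spaces.linear scl scl p" "p r0 \<noteq> 0"
    "\<And>r. \<sigma> r = - r \<Longrightarrow> \<sigma> (p r) = - p r" "\<And>r. \<sigma> r = - r \<Longrightarrow> \<exists>n. r * p r = scl n 1"
    using pfaffian[OF r0] by blast
  have "\<exists>q qK. Vector_Spaces.linear scl scl q \<and> extended_map scaleK \<iota> q qK \<and> qK s = s \<and>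
      (\<forall>r. \<sigma> r = - r \<longrightarrow> \<sigma> (q r) = - q r \<and> (\<exists>n. r * q r = scl n 1) \<and> q (q r) = r)"
    by (rule pfaffian_normalization[where p = p and ?r0.0 = r0])
      (use p r0 s conic.square_descends in blast)+
  then obtain q qK where q: "Vector_Spaces.linear scl scl q" and qK: "extended_map scaleK \<iota> q qK" "qK s = s"
    and q_skew: "\<forall>r. \<sigma> r = - r \<longrightarrow> \<sigma> (q r) = - q r \<and> (\<exists>n. r * q r = scl n 1) \<and> q (q r) = r"
    by blast
  have qK_lin: "qK (u + v) = qK u + qK v" "qK (scaleK k u) = scaleK k (qK u)" "qK (\<iota> x) = \<iota> (q x)" for u v k x
    using qK(1) by (auto simp: extended_map_def Vector_Spaces.linear_iff)
  interpret P: pfaffian_involution scl \<sigma> q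
    by (intro pfaffian_involution.intro F.involution_algebra_axioms pfaffian_involution_axioms.intro)
      (fact q sandwich skew_center | use q_skew in blast)+
  show ?thesis
  proof (cases "\<exists>r\<in>P.Plus. r \<noteq> 0 \<and> r * r = 0")
    case True
    then show ?thesis using P.isotropic_imp_hyperbolic by blast
  next
    case False
    then have an: "r = 0" if "r \<in> P.Plus" "r * r = 0" for r using that by blast
    have Plus: "x + q x \<in> P.Plus" if "\<sigma> x = - x" for x
      using that by (simp add: P.Plus_def F.\<sigma>_simps q_skew P.p_add add.commute)
    have ne: "P.Plus \<noteq> {0}"
    proof
      assume "P.Plus = {0}"
      \<comment> \<open>With \<open>Plus\<close> zero, \<open>x + q x = 0\<close> for all skew
        \<open>x\<close>, and this passes to \<open>K\<close>; but
        \<open>s + qK s = 2 s\<close>.\<close>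
      have "s + qK s = 0"
        using s(1)
      proof (induction s rule: skew_extended_induct)
        case (scale k x)
        have "\<iota> (x + q x) = 0" using Plus[OF scale] \<open>P.Plus = {0}\<close> by (simp add: \<iota>_0)
        then show ?case by (simp add: qK_lin \<iota>_add flip: B.scale_right_distrib)
      next
        case (add u v)
        then show ?case by (simp add: qK_lin) (metis add.assoc add.commute add.right_neutral)
      qed
      then show False using qK(2) s0 K.double_eq_0[of s] by simp
    qed
    obtain e f c d where cd: "c \<noteq> 0" "d \<noteq> 0"
      and ef: "e \<in> P.Plus" "f \<in> P.Plus" "e * f \<in> P.Plus"
      and rel: "e * e = scl c 1" "f * f = scl d 1" "f * e = - (e * f)"
      and span: "\<And>x. x \<in> P.Plus \<Longrightarrow> \<exists>k l m. x = scl k e + scl l f + scl m (e * f)"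
    proof (rule P.Plus_basis[OF _ ne])
      show "r = 0" if "r \<in> P.Plus" "r * r = 0" for r using that by (rule an)
    qed (rule that)
    have el_Plus: "F.pure_element e f u \<in> P.Plus" for u
      unfolding F.pure_element_def by (intro P.Plus_add P.Plus_scale ef)
    have an': "anisotropic 3 (pure_form c d)"
      unfolding anisotropic_def
    proof (intro allI impI)
      fix u :: "nat \<Rightarrow> 'f" and i :: nat
      assume u: "diag_bilin 3 (pure_form c d) u u = 0" and "i < 3"
      then have "i = 0 \<or> i = 1 \<or> i = 2" by linarith
      \<comment> \<open>That the element vanishes does not yet concern its coordinates; they are
        read off by pairing with coordinate vectors, since \<open>c\<close> and \<open>d\<close> are
        nonzero.\<close>
      have "F.pure_element e f u = 0"
        using u an[OF el_Plus] F.pure_element_square[OF rel] by simp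
      then have "diag_bilin 3 (pure_form c d) u v = 0" for v
        using F.pure_element_mult[OF rel, of u v] two by simp
      from this[of "\<lambda>j. if j = i then 1 else 0"] show "u i = 0"
        using \<open>i = 0 \<or> i = 1 \<or> i = 2\<close> cd by (auto simp: diag_bilin_3 pure_form_def split: if_splits)
    qed
    have relK: "\<iota> e * \<iota> e = scaleK (\<epsilon> c) 1" "\<iota> f * \<iota> f = scaleK (\<epsilon> d) 1" "\<iota> f * \<iota> e = - (\<iota> e * \<iota> f)"
      by (simp_all add: rel \<iota>_scale \<iota>_one \<iota>_minus flip: \<iota>_mul)
    \<comment> \<open>\<open>x \<mapsto> x + q x\<close> maps skew elements into
      \<open>Plus\<close>, so \<open>s + qK s = 2 s\<close> lies in the \<open>K\<close>-span of
      \<open>e\<close>, \<open>f\<close> and \<open>e f\<close>.\<close>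
    have "\<exists>z. s + qK s = K.pure_element (\<iota> e) (\<iota> f) z"
      using s(1)
    proof (induction s rule: skew_extended_induct)
      case (scale k x)
      obtain z0 z1 z2 where z: "x + q x = scl z0 e + scl z1 f + scl z2 (e * f)"
        using span[OF Plus[OF scale]] by blast
      have "scaleK k (\<iota> x) + qK (scaleK k (\<iota> x)) = scaleK k (\<iota> (x + q x))"
        by (simp add: qK_lin \<iota>_add B.scale_right_distrib)
      also have "\<dots> = K.pure_element (\<iota> e) (\<iota> f)
          (\<lambda>i. if i = 0 then k * \<epsilon> z0 else if i = 1 then k * \<epsilon> z1 else k * \<epsilon> z2)"
        by (simp add: z K.pure_element_def \<iota>_add \<iota>_scale \<iota>_mul B.scale_right_distrib)
      finally show ?case by blast
    next
      case (add u v)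
      then obtain z w where "u + qK u = K.pure_element (\<iota> e) (\<iota> f) z" "v + qK v = K.pure_element (\<iota> e) (\<iota> f) w"
        by blast
      then have "(u + v) + qK (u + v) = K.pure_element (\<iota> e) (\<iota> f) z + K.pure_element (\<iota> e) (\<iota> f) w"
        by (simp add: qK_lin) (metis add.assoc add.commute)
      also have "\<dots> = K.pure_element (\<iota> e) (\<iota> f) (\<lambda>i. z i + w i)"
        by (simp add: K.pure_element_def B.scale_left_distrib algebra_simps)
      finally show ?case by blast
    qed
    then obtain z' where z': "s + s = K.pure_element (\<iota> e) (\<iota> f) z'" using qK(2) by auto
    define z where "z i = 1 / 2 * z' i" for i
    have "s = scaleK (1 / 2) (K.pure_element (\<iota> e) (\<iota> f) z')"
      by (simp only: z'[symmetric] K.scale_half_double)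
    also have "\<dots> = K.pure_element (\<iota> e) (\<iota> f) z"
      by (simp add: K.pure_element_def z_def B.scale_right_distrib)
    finally have z: "s = K.pure_element (\<iota> e) (\<iota> f) z" .
    have "pure_form (\<epsilon> c) (\<epsilon> d) = (\<lambda>i. \<epsilon> (pure_form c d i))"
      by (auto simp: pure_form_def fun_eq_iff hom_simps)
    then have "scaleK (diag_bilin 3 (\<lambda>i. \<epsilon> (pure_form c d i)) z z) 1 = scaleK 1 (1 :: 'b)"
      using s(2) K.pure_element_square[OF relK, of z] by (simp flip: z)
    then have "diag_bilin 3 (\<lambda>i. \<epsilon> (pure_form c d i)) z z = 1"
      by (simp only: K.scale_one_eq)
    from conic.pure_form_represents[OF an' this] show ?thesis
    proof (elim disjE exE conjE)
      fix w assume "diag_bilin 3 (pure_form c d) w w = 1"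
      then have "F.pure_element e f w * F.pure_element e f w = 1"
        by (simp add: F.pure_element_square[OF rel])
      then show ?thesis using el_Plus[of w] unfolding F.hyperbolic_iff P.Plus_def by blast
    next
      fix v w
      assume vw: "diag_bilin 3 (pure_form c d) v v = b" "diag_bilin 3 (pure_form c d) w w = - (a * b)"
        "diag_bilin 3 (pure_form c d) v w = 0"
      define J k where "J = F.pure_element e f v" and "k = F.pure_element e f w"
      have J: "J * J = scl b 1" and k: "k * k = scl (- (a * b)) 1"
        by (simp_all add: J_def k_def F.pure_element_square[OF rel] vw)
      have "J * k + k * J = 0"
        unfolding J_def k_def F.pure_element_mult[OF rel] vw by simp
      then have kJ: "k * J = - (J * k)" by (simp add: eq_neg_iff_add_eq_0 add.commute)
      have skew: "\<sigma> J = - J" "\<sigma> k = - k" using el_Plus by (auto simp: J_def k_def P.Plus_def)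
      have JJ: "J * (J * u) = scl b u" "k * (J * u) = - (J * (k * u))" for u
        by (simp_all add: J kJ A.mul_scale_left flip: mult.assoc)
      \<comment> \<open>\<open>(J k)^2 = - J^2 k^2 = a b^2\<close>, so division by \<open>b\<close>
        gives the square \<open>a\<close>.\<close>
      define I where "I = scl (inverse b) (J * k)"
      have "\<sigma> I = - I" by (simp add: I_def F.\<sigma>_simps skew kJ)
      moreover have "I * I = scl a 1" using conic.b0
        by (simp add: I_def A.mul_scale_left A.mul_scale_right mult.assoc JJ k J) (simp add: field_simps)
      moreover have "J * I = - (I * J)"
        by (simp add: I_def A.mul_scale_left A.mul_scale_right mult.assoc kJ)
      ultimately show ?thesis
        using F.containsI[OF conic.a0 conic.b0 _ skew(1) _ J] by blast
    qed
  qed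
qed

theorem corollary3p2:
  fixes a b :: "'f::field"
    and scaleA :: "'f \<Rightarrow> 'a::ring_1 \<Rightarrow> 'a" and \<sigma> :: "'a \<Rightarrow> 'a"
    and \<epsilon> :: "'f \<Rightarrow> 'k::field"
    and scaleK :: "'k \<Rightarrow> 'b::ring_1 \<Rightarrow> 'b" and \<iota> :: "'a \<Rightarrow> 'b" and \<sigma>K :: "'b \<Rightarrow> 'b"
  assumes "(2 :: 'f) \<noteq> 0"
    and "a \<noteq> 0" and "b \<noteq> 0" and "\<not> quat_split a b"
    and "central_simple_algebra scaleA (*) 1" and "has_degree scaleA 4"
    and "orthogonal_involution TYPE('l::field) TYPE(4) scaleA (*) 1 \<sigma>"
    and "conic_function_field a b \<epsilon>"
    and "scalar_extension scaleA (*) 1 \<epsilon> scaleK (*) 1 \<iota>"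
    and "extended_map scaleK \<iota> \<sigma> \<sigma>K"
  shows "hyperbolic (*) 1 \<sigma>K \<longleftrightarrow>
           hyperbolic (*) 1 \<sigma> \<or>
           contains_with_involution scaleA (*) 1 \<sigma> quat_scale (quat_mul a b) quat_one quat_conj"
proof -
  interpret A: central_simple_algebra scaleA "(*)" 1 by fact
  have inv: "involution scaleA (*) \<sigma>"
    using assms(7) by (simp add: orthogonal_involution_def)
  obtain \<epsilon>L :: "'f \<Rightarrow> 'l" and \<phi> \<tau> and \<beta> :: "'l^4 \<Rightarrow> 'l^4 \<Rightarrow> 'l"
    where L: "scalar_extension scaleA (*) 1 \<epsilon>L mat_scale (**) (mat 1) \<phi>"
      "extended_map mat_scale \<phi> \<sigma> \<tau>" "symmetric_nondegenerate_form \<beta>"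
      "\<And>M v w. \<beta> (M *v v) w = \<beta> v (\<tau> M *v w)"
    using assms(7) unfolding orthogonal_involution_def by blast
  \<comment> \<open>Two extensions are in play: \<open>L\<close> splits \<open>A\<close> and
    supplies the Pfaffian adjoint and the two nondegeneracy facts over \<open>F\<close>, while
    \<open>K\<close> is the function field of the conic.\<close>
  interpret L: split_orthogonal scaleA \<epsilon>L \<phi> \<sigma> \<tau> \<beta>
    using L inv assms(1) A.finite_dim A.assoc_algebra_axioms by unfold_locales
  interpret K: base_change_involution scaleA \<epsilon> scaleK \<iota> \<sigma> \<sigma>K
    using assms inv A.assoc_algebra_axioms by unfold_locales
  obtain x y where "conic_point a b \<epsilon> x y"
    using assms(1-3,8) unfolding conic_function_field_def conic_point_def by blast
  then interpret conic: conic_point a b \<epsilon> x y .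
  show ?thesis
  proof (intro iffI)
    assume "hyperbolic (*) 1 \<sigma>K"
    then show "hyperbolic (*) 1 \<sigma> \<or>
        contains_with_involution scaleA (*) 1 \<sigma> quat_scale (quat_mul a b) quat_one quat_conj"
      using K.hyperbolic_descent[OF conic.conic_point_axioms L.skew_sandwich_eq_0 L.skew_central_eq_0
          L.pfaffian_adjoint_exists] by blast
  next
    assume "hyperbolic (*) 1 \<sigma> \<or>
        contains_with_involution scaleA (*) 1 \<sigma> quat_scale (quat_mul a b) quat_one quat_conj"
    then show "hyperbolic (*) 1 \<sigma>K"
      using K.hyperbolic_extended K.F.containsD K.hyperbolic_of_quaternions conic.curve_eq' by metis
  qed
qed

end
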